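(* Let $m\in\mathbb R$ and $a\in S^m_{1,0}(\mathbb T^d\times\mathbb Z^d)$. Then $$A_a:\mathcal D'_+(\mathbb T^d)\longrightarrow\mathcal D'_+(\mathbb T^d)$$ is (well defined and) continuous if and only if $a$ satisfies the triangular condition $$a_\nu(n)=0\quad\text{whenever}\quad n\in\mathbb N_0^d\ \text{ and }\ n+\nu\notin\mathbb N_0^d .$$
   Context: Fix $d\in\mathbb N$; $\mathbb T^d=\mathbb R^d/(2\pi\mathbb Z)^d$. For $f\in L^1(\mathbb T^d)$, $\widehat f(n)=(2\pi)^{-d}\int_{[0,2\pi]^d}f(x)e^{-in\cdot x}\,dx$, $n\in\mathbb Z^d$, extended by duality to the space $\mathcal D'(\mathbb T^d)$ of periodic distributions. $\mathcal D'_+(\mathbb T^d)=\{f\in\mathcal D'(\mathbb T^d):\widehat f(n)=0\text{ for }n\notin\mathbb N_0^d\}$, with the topology inherited from $\mathcal D'(\mathbb T^d)$. Discrete differences: $\Delta_{n_j}g(n)=g(n+e_j)-g(n)$, $\Delta_n^\alpha=\Delta_{n_1}^{\alpha_1}\cdots\Delta_{n_d}^{\alpha_d}$; $\langle n\rangle=(1+|n|^2)^{1/2}$. $S^m_{1,0}(\mathbb T^d\times\mathbb Z^d)$ is the class of functions $a:\mathbb T^d\times\mathbb Z^d\to\mathbb C$, smooth in $x$, with $\sup_{x,n}\langle n\rangle^{-m+|\alpha|}|\Delta_n^\alpha\partial_x^\beta a(x,n)|<\infty$ for all $\alpha,\beta\in\mathbb N_0^d$. The toroidal quantization is $A_af(x)=\sum_{n\in\mathbb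 Z^d}a(x,n)\widehat f(n)e^{in\cdot x}$ (understood in the sense of distributions for $f\in\mathcal D'(\mathbb T^d)$). The $x$-Fourier coefficients of the symbol are $a_\nu(n)=(2\pi)^{-d}\int_{[0,2\pi]^d}a(x,n)e^{-i\nu\cdot x}\,dx$, $\nu\in\mathbb Z^d$. *)

theory Defs
  imports "HOL-Analysis.Analysis"
begin

text \<open>The dimension \<open>d\<close> is \<open>CARD('d)\<close>. Functions on the torus are functions on
  \<open>real ^ 'd\<close> that are \<open>2\<pi>\<close>-periodic in each coordinate.\<close>

subsection \<open>Multi-indices, differences and derivatives\<close>

definition coords :: "'d::finite list" where
  "coords = (SOME js. distinct js \<and> set js = UNIV)"

text \<open>The operators \<open>D j\<close> are applied \<open>\<alpha> $ j\<close> times each; the coordinates are taken in an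
  arbitrary fixed order, which is immaterial for differences and for partial derivatives of smooth functions.\<close>

definition multi_power :: "('d::finite \<Rightarrow> 'g \<Rightarrow> 'g) \<Rightarrow> nat ^ 'd \<Rightarrow> 'g \<Rightarrow> 'g" where
  "multi_power D \<alpha> = foldr (\<lambda>j. D j ^^ (\<alpha> $ j)) coords"

definition difference :: "'d::finite \<Rightarrow> (int ^ 'd \<Rightarrow> complex) \<Rightarrow> int ^ 'd \<Rightarrow> complex" where
  "difference j g = (\<lambda>n. g (n + axis j 1) - g n)"

definition partial_deriv :: "'d::finite \<Rightarrow> (real ^ 'd \<Rightarrow> complex) \<Rightarrow> real ^ 'd \<Rightarrow> complex" where
  "partial_deriv j f = (\<lambda>x. vector_derivative (\<lambda>t. f (x + t *\<^sub>R axis j 1)) (at 0))"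

abbreviation multi_difference :: "nat ^ 'd::finite \<Rightarrow> (int ^ 'd \<Rightarrow> complex) \<Rightarrow> int ^ 'd \<Rightarrow> complex" where
  "multi_difference \<equiv> multi_power difference"

abbreviation multi_deriv :: "nat ^ 'd::finite \<Rightarrow> (real ^ 'd \<Rightarrow> complex) \<Rightarrow> real ^ 'd \<Rightarrow> complex" where
  "multi_deriv \<equiv> multi_power partial_deriv"

primrec C_k :: "nat \<Rightarrow> (real ^ 'd::finite \<Rightarrow> complex) \<Rightarrow> bool" where
  "C_k 0 f \<longleftrightarrow> continuous_on UNIV f"
| "C_k (Suc k) f \<longleftrightarrow> (\<forall>x. f differentiable (at x)) \<and> (\<forall>j. C_k k (partial_deriv j f))"

definition smooth :: "(real ^ 'd::finite \<Rightarrow> complex) \<Rightarrow> bool" where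
  "smooth f \<longleftrightarrow> (\<forall>k. C_k k f)"

definition periodic :: "(real ^ 'd::finite \<Rightarrow> complex) \<Rightarrow> bool" where
  "periodic f \<longleftrightarrow> (\<forall>j x. f (x + axis j (2 * pi)) = f x)"


subsection \<open>Topologies given by seminorms\<close>

definition seminorm_topology :: "'v::minus set \<Rightarrow> ('v \<Rightarrow> real) set \<Rightarrow> 'v topology" where
  "seminorm_topology S P =
     topology_generated_by {{y \<in> S. p (y - x) < e} | p x e. p \<in> P \<and> x \<in> S \<and> 0 < e}"


subsection \<open>Test functions and periodic distributions\<close>

definition test_functions :: "(real ^ 'd::finite \<Rightarrow> complex) set" where
  "test_functions = {\<phi>. smooth \<phi> \<and> periodic \<phi>}"

definition test_seminorm :: "nat ^ 'd::finite \<Rightarrow> (real ^ 'd \<Rightarrow> complex) \<Rightarrow> real" where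
  "test_seminorm \<beta> \<phi> = (SUP x. norm (multi_deriv \<beta> \<phi> x))"

definition test_topology :: "(real ^ 'd::finite \<Rightarrow> complex) topology" where
  "test_topology = seminorm_topology test_functions (range test_seminorm)"

definition bounded_test_sets :: "(real ^ 'd::finite \<Rightarrow> complex) set set" where
  "bounded_test_sets =
     {B. B \<noteq> {} \<and> B \<subseteq> test_functions \<and> (\<forall>\<beta>. bdd_above (test_seminorm \<beta> ` B))}"

text \<open>Functionals are \<open>undefined\<close> off the test functions, so that equality of distributions is
  equality of functions.\<close>

definition distributions :: "((real ^ 'd::finite \<Rightarrow> complex) \<Rightarrow> complex) set" where
  "distributions = {u \<in> extensional test_functions.
     (\<forall>\<phi>\<in>test_functions. \<forall>\<psi>\<in>test_functions. u (\<lambda>x. \<phi> x + \<psi> x) = u \<phi> + u \<psi>) \<and>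
     (\<forall>c. \<forall>\<phi>\<in>test_functions. u (\<lambda>x. c * \<phi> x) = c * u \<phi>) \<and>
     continuous_map test_topology euclidean u}"

text \<open>The two customary topologies of the dual of the space of test functions: uniform convergence
  on bounded sets, and pointwise convergence.\<close>

definition strong_dual_topology :: "((real ^ 'd::finite \<Rightarrow> complex) \<Rightarrow> complex) topology" where
  "strong_dual_topology =
     seminorm_topology distributions {\<lambda>u. SUP \<phi>\<in>B. norm (u \<phi>) | B. B \<in> bounded_test_sets}"

definition weak_star_topology :: "((real ^ 'd::finite \<Rightarrow> complex) \<Rightarrow> complex) topology" where
  "weak_star_topology =
     subtopology (product_topology (\<lambda>_. euclidean) test_functions) distributions"


subsection \<open>Fourier coefficients\<close>

definition real_vec :: "int ^ 'd::finite \<Rightarrow> real ^ 'd" where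
  "real_vec n = (\<chi> j. real_of_int (n $ j))"

definition character :: "int ^ 'd::finite \<Rightarrow> real ^ 'd \<Rightarrow> complex" where
  "character n x = exp (\<i> * of_real (real_vec n \<bullet> x))"

definition torus_integral :: "(real ^ 'd::finite \<Rightarrow> complex) \<Rightarrow> complex" where
  "torus_integral f = (LINT x : cbox 0 (\<chi> j. 2 * pi) | lborel. f x)"

definition fourier_coeff :: "(real ^ 'd::finite \<Rightarrow> complex) \<Rightarrow> int ^ 'd \<Rightarrow> complex" where
  "fourier_coeff f n = torus_integral (\<lambda>x. f x * character (- n) x) / (2 * of_real pi) ^ CARD('d)"

text \<open>A function \<open>f\<close> acts on test functions by integrating \<open>f \<phi>\<close>, without normalising
  the measure.\<close>

definition distribution_of ::
    "(real ^ 'd::finite \<Rightarrow> complex) \<Rightarrow> (real ^ 'd \<Rightarrow> complex) \<Rightarrow> complex" where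
  "distribution_of f = (\<lambda>\<phi>\<in>test_functions. torus_integral (\<lambda>x. f x * \<phi> x))"

definition distr_fourier_coeff ::
    "((real ^ 'd::finite \<Rightarrow> complex) \<Rightarrow> complex) \<Rightarrow> int ^ 'd \<Rightarrow> complex" where
  "distr_fourier_coeff u n = u (character (- n)) / (2 * of_real pi) ^ CARD('d)"

definition nonneg_lattice :: "(int ^ 'd::finite) set" where
  "nonneg_lattice = {n. \<forall>j. 0 \<le> n $ j}"

definition plus_distributions :: "((real ^ 'd::finite \<Rightarrow> complex) \<Rightarrow> complex) set" where
  "plus_distributions =
     {u \<in> distributions. \<forall>n. n \<notin> nonneg_lattice \<longrightarrow> distr_fourier_coeff u n = 0}"


subsection \<open>Symbols and toroidal quantization\<close>

definition bracket :: "int ^ 'd::finite \<Rightarrow> real" where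
  "bracket n = sqrt (1 + (norm (real_vec n))\<^sup>2)"

definition symbol_class :: "real \<Rightarrow> (real ^ 'd::finite \<Rightarrow> int ^ 'd \<Rightarrow> complex) set" where
  "symbol_class m = {a.
     (\<forall>n. smooth (\<lambda>x. a x n) \<and> periodic (\<lambda>x. a x n)) \<and>
     (\<forall>\<alpha> \<beta>. bdd_above (range (\<lambda>(x, n).
        bracket n powr (- m + real (\<Sum>j\<in>UNIV. \<alpha> $ j)) *
        norm (multi_difference \<alpha> (\<lambda>k. multi_deriv \<beta> (\<lambda>y. a y k) x) n))))}"

definition symbol_coeff ::
    "(real ^ 'd::finite \<Rightarrow> int ^ 'd \<Rightarrow> complex) \<Rightarrow> int ^ 'd \<Rightarrow> int ^ 'd \<Rightarrow> complex" where
  "symbol_coeff a \<nu> n = fourier_coeff (\<lambda>x. a x n) \<nu>"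

definition quantization_term ::
    "(real ^ 'd::finite \<Rightarrow> int ^ 'd \<Rightarrow> complex) \<Rightarrow> ((real ^ 'd \<Rightarrow> complex) \<Rightarrow> complex) \<Rightarrow>
     int ^ 'd \<Rightarrow> (real ^ 'd \<Rightarrow> complex) \<Rightarrow> complex" where
  "quantization_term a f n =
     distribution_of (\<lambda>x. a x n * distr_fourier_coeff f n * character n x)"

definition quantization_converges ::
    "(real ^ 'd::finite \<Rightarrow> int ^ 'd \<Rightarrow> complex) \<Rightarrow> ((real ^ 'd \<Rightarrow> complex) \<Rightarrow> complex) \<Rightarrow> bool" where
  "quantization_converges a f \<longleftrightarrow>
     (\<forall>\<phi>\<in>test_functions. (\<lambda>n. quantization_term a f n \<phi>) summable_on UNIV)"

text \<open>The series over the lattice is summed in the sense of distributions, that is, after pairing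
  with a test function.\<close>

definition quantization ::
    "(real ^ 'd::finite \<Rightarrow> int ^ 'd \<Rightarrow> complex) \<Rightarrow> ((real ^ 'd \<Rightarrow> complex) \<Rightarrow> complex) \<Rightarrow>
     (real ^ 'd \<Rightarrow> complex) \<Rightarrow> complex" where
  "quantization a f = (\<lambda>\<phi>\<in>test_functions. \<Sum>\<^sub>\<infinity>n. quantization_term a f n \<phi>)"

definition triangular :: "(real ^ 'd::finite \<Rightarrow> int ^ 'd \<Rightarrow> complex) \<Rightarrow> bool" where
  "triangular a \<longleftrightarrow>
     (\<forall>n \<nu>. n \<in> nonneg_lattice \<and> n + \<nu> \<notin> nonneg_lattice \<longrightarrow> symbol_coeff a \<nu> n = 0)"

end

theory Submission
  imports Defs
begin

text \<open>Everything is done by duality. Paired with a test function \<open>\<phi>\<close>, the \<open>n\<close>-th term of the series for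
  \<open>A f\<close> (with \<open>A\<close> the quantization of \<open>a\<close>) is \<open>c n * f (character (- n))\<close>, where \<open>c n\<close> is
  \<open>(2 \<pi>) ^ (- d)\<close> times the integral of \<open>a x n * character n x * \<phi> x\<close>. Integrating by parts repeatedly
  along the largest coordinate of \<open>n\<close> and estimating the \<open>x\<close>-derivatives of \<open>a\<close> by \<open>bracket n powr m\<close>
  shows that \<open>c n\<close> decays faster than every power of \<open>bracket n\<close>, with constants that are
  multiples of finite sums of seminorms of \<open>\<phi>\<close> (lemma \<open>transpose_coeff_decay\<close>).

  Hence the Fourier series \<open>\<Sum> c n * character (- n)\<close> converges in the space of test functions. Its sum is
  called \<open>transposed a \<phi>\<close>, and as a distribution \<open>f\<close> is dominated by finitely many seminorms, it may be
  applied term by term: the series for \<open>A f\<close> converges and \<open>A f \<phi> = f (transposed a \<phi>)\<close> (lemmas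
  \<open>distribution_fourier_sum\<close> and \<open>quantization_has_sum\<close>). The operator \<open>transposed a\<close> is linear and each of
  its seminorms is dominated by finitely many seminorms of the argument. Therefore \<open>A f\<close> is a
  distribution, and \<open>A\<close> is continuous on the space of distributions for both topologies of the dual:
  evaluation at \<open>\<phi>\<close> is pulled back to evaluation at \<open>transposed a \<phi>\<close>, and the seminorm of a bounded
  set to the seminorm of its image, which is bounded (lemma \<open>continuous_map_transpose\<close>).

  The statement thus reduces to the question whether \<open>A\<close> maps the distributions with spectrum in the
  nonnegative orthant to themselves. The \<open>k\<close>-th Fourier coefficient of \<open>A f\<close> is the sum over \<open>n\<close> of the
  \<open>(k - n)\<close>-th coefficient of \<open>a\<close> at \<open>n\<close> times the \<open>n\<close>-th coefficient of \<open>f\<close>. Under the triangular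
  condition every term vanishes for \<open>k\<close> outside the orthant; conversely, \<open>f = character n\<close> with \<open>n\<close> in
  the orthant isolates the single coefficient that has to vanish.\<close>

section \<open>Topologies generated by seminorms\<close>

definition seminorm_ball :: "'v::minus set \<Rightarrow> ('v \<Rightarrow> real) set \<Rightarrow> 'v \<Rightarrow> real \<Rightarrow> 'v set" where
  "seminorm_ball S F x e = {y \<in> S. \<forall>p\<in>F. p (y - x) < e}"

lemma seminorm_ball_mono:
  assumes "F \<subseteq> F'" "e' \<le> e"
  shows "seminorm_ball S F' x e' \<subseteq> seminorm_ball S F x e"
  unfolding seminorm_ball_def using assms by (auto intro: less_le_trans)

lemma topspace_seminorm_topology:
  assumes "P \<noteq> {}" and zero: "\<And>p x. p \<in> P \<Longrightarrow> x \<in> S \<Longrightarrow> p (x - x) = 0"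
  shows "topspace (seminorm_topology S P) = S"
proof -
  obtain p where "p \<in> P" using assms(1) by blast
  have "x \<in> \<Union>{{y \<in> S. p (y - x) < e} | p x e. p \<in> P \<and> x \<in> S \<and> 0 < e}" if "x \<in> S" for x
  proof (rule UnionI)
    show "{y \<in> S. p (y - x) < 1} \<in> {{y \<in> S. p (y - x) < e} | p x e. p \<in> P \<and> x \<in> S \<and> 0 < e}"
      using \<open>p \<in> P\<close> that zero_less_one by blast
    show "x \<in> {y \<in> S. p (y - x) < 1}" using that zero[OF \<open>p \<in> P\<close> that] by simp
  qed
  then show ?thesis
    unfolding seminorm_topology_def topology_generated_by_topspace by blast
qed

text \<open>The generating sets are balls of single seminorms around arbitrary centres; by the triangle
  inequality such a ball contains a ball around each of its points, so finite intersections
  of concentric balls form a neighbourhood base.\<close>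
lemma openin_seminorm_topology_iff:
  fixes S :: "'v::minus set"
  assumes "P \<noteq> {}" and zero: "\<And>p x. p \<in> P \<Longrightarrow> x \<in> S \<Longrightarrow> p (x - x) = 0"
    and triangle: "\<And>p x y z. p \<in> P \<Longrightarrow> x \<in> S \<Longrightarrow> y \<in> S \<Longrightarrow> z \<in> S
       \<Longrightarrow> p (x - z) \<le> p (x - y) + p (y - z)"
  shows "openin (seminorm_topology S P) U \<longleftrightarrow>
    U \<subseteq> S \<and> (\<forall>x\<in>U. \<exists>F e. finite F \<and> F \<subseteq> P \<and> 0 < e \<and> seminorm_ball S F x e \<subseteq> U)"
    (is "?L \<longleftrightarrow> ?R")
proof
  assume ?L
  then have "generate_topology_on {{y \<in> S. p (y - x) < e} | p x e. p \<in> P \<and> x \<in> S \<and> 0 < e} U"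
    unfolding seminorm_topology_def openin_topology_generated_by_iff .
  then show ?R
  proof (induction U rule: generate_topology_on.induct)
    case Empty
    then show ?case by simp
  next
    case (Int U V)
    show ?case
    proof (intro conjI ballI)
      show "U \<inter> V \<subseteq> S" using Int.IH(1) by blast
      fix x assume "x \<in> U \<inter> V"
      then have "x \<in> U" "x \<in> V" by auto
      obtain F e where F: "finite F" "F \<subseteq> P" "0 < e" "seminorm_ball S F x e \<subseteq> U"
        using bspec[OF conjunct2[OF Int.IH(1)] \<open>x \<in> U\<close>] by (elim exE conjE) (rule that)
      obtain F' e' where F': "finite F'" "F' \<subseteq> P" "0 < e'" "seminorm_ball S F' x e' \<subseteq> V"
        using bspec[OF conjunct2[OF Int.IH(2)] \<open>x \<in> V\<close>] by (elim exE conjE) (rule that)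
      have "seminorm_ball S (F \<union> F') x (min e e') \<subseteq> U \<inter> V"
        using F(4) F'(4) seminorm_ball_mono[of F "F \<union> F'" "min e e'" e S x]
          seminorm_ball_mono[of F' "F \<union> F'" "min e e'" e' S x] by auto
      then show "\<exists>F e. finite F \<and> F \<subseteq> P \<and> 0 < e \<and> seminorm_ball S F x e \<subseteq> U \<inter> V"
        using F F' by (intro exI[of _ "F \<union> F'"] exI[of _ "min e e'"]) simp
    qed
  next
    case (UN K)
    show ?case
    proof (intro conjI ballI)
      show "\<Union>K \<subseteq> S" using UN.IH by blast
      fix x assume "x \<in> \<Union>K"
      then obtain k where "k \<in> K" "x \<in> k" by blast
      then obtain F e where "finite F" "F \<subseteq> P" "0 < e" "seminorm_ball S F x e \<subseteq> k"
        using bspec[OF conjunct2[OF UN.IH[OF \<open>k \<in> K\<close>]] \<open>x \<in> k\<close>] by (elim exE conjE) (rule that)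
      with \<open>k \<in> K\<close>
      show "\<exists>F e. finite F \<and> F \<subseteq> P \<and> 0 < e \<and> seminorm_ball S F x e \<subseteq> \<Union>K" by blast
    qed
  next
    case (Basis s)
    then obtain p x e where s: "s = {y \<in> S. p (y - x) < e}" "p \<in> P" "x \<in> S"
      unfolding mem_Collect_eq by (elim exE conjE) (rule that)
    have "\<exists>F e. finite F \<and> F \<subseteq> P \<and> 0 < e \<and> seminorm_ball S F y e \<subseteq> s" if "y \<in> s" for y
    proof (intro exI conjI)
      show "finite {p}" "{p} \<subseteq> P" "0 < e - p (y - x)" using s that by auto
      show "seminorm_ball S {p} y (e - p (y - x)) \<subseteq> s"
      proof
        fix z assume z: "z \<in> seminorm_ball S {p} y (e - p (y - x))"
        then have "p (z - x) < e"
          using triangle[OF s(2) _ _ s(3), of z y] that s(1) by (simp add: seminorm_ball_def)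
        with z show "z \<in> s" by (simp add: s(1) seminorm_ball_def)
      qed
    qed
    then show ?case using s(1) by blast
  qed
next
  assume R: ?R
  have ball: "openin (seminorm_topology S P) (seminorm_ball S F x e)"
    if "finite F" "F \<subseteq> P" "0 < e" "x \<in> S" for F x and e :: real
    using that(1,2)
  proof (induction F)
    case empty
    have "topspace (seminorm_topology S P) = S"
      by (rule topspace_seminorm_topology[where P = P, OF assms(1)]) (rule zero)
    then show ?case
      using openin_topspace[of "seminorm_topology S P"] by (simp add: seminorm_ball_def)
  next
    case (insert p F)
    have "openin (seminorm_topology S P) {y \<in> S. p (y - x) < e}"
      unfolding seminorm_topology_def using insert.prems that(3,4)
      by (intro topology_generated_by_Basis, unfold mem_Collect_eq)
        (intro exI[of _ p] exI[of _ x] exI[of _ e], simp)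
    then have "openin (seminorm_topology S P) ({y \<in> S. p (y - x) < e} \<inter> seminorm_ball S F x e)"
      using insert by blast
    moreover have "{y \<in> S. p (y - x) < e} \<inter> seminorm_ball S F x e = seminorm_ball S (insert p F) x e"
      by (auto simp: seminorm_ball_def)
    ultimately show ?case by simp
  qed
  show ?L
  proof (subst openin_subopen, intro ballI)
    fix x assume "x \<in> U"
    with R have "x \<in> S" by auto
    obtain F e where F: "finite F" "F \<subseteq> P" "0 < e" "seminorm_ball S F x e \<subseteq> U"
      using bspec[OF conjunct2[OF R] \<open>x \<in> U\<close>] by (elim exE conjE) (rule that)
    have "x \<in> seminorm_ball S F x e"
      unfolding seminorm_ball_def
    proof (intro CollectI conjI ballI)
      show "p (x - x) < e" if "p \<in> F" for p
        using zero[of p x] F(2,3) \<open>x \<in> S\<close> that by auto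
    qed (rule \<open>x \<in> S\<close>)
    then show "\<exists>T. openin (seminorm_topology S P) T \<and> x \<in> T \<and> T \<subseteq> U"
      using ball[OF F(1-3) \<open>x \<in> S\<close>] F(4) by blast
  qed
qed

section \<open>Smooth periodic functions\<close>

lemma smooth_differentiable: "smooth f \<Longrightarrow> f differentiable (at x)"
  unfolding smooth_def using C_k.simps(2) by blast

lemma smooth_continuous: "smooth f \<Longrightarrow> continuous_on UNIV f"
  unfolding smooth_def using C_k.simps(1) by blast

lemma smooth_partial_deriv: "smooth f \<Longrightarrow> smooth (partial_deriv j f)"
  unfolding smooth_def using C_k.simps(2) by blast

lemma has_partial_derivI:
  fixes f :: "real ^ 'd::finite \<Rightarrow> complex"
  assumes "(f has_derivative D) (at x)"
  shows "((\<lambda>t. f (x + t *\<^sub>R axis j 1)) has_vector_derivative D (axis j 1)) (at 0)"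
proof -
  have "((\<lambda>t. x + t *\<^sub>R axis j 1) has_derivative (\<lambda>t. t *\<^sub>R axis j 1)) (at 0)"
    by (auto intro!: derivative_eq_intros)
  then have "((\<lambda>t. f (x + t *\<^sub>R axis j 1)) has_derivative (\<lambda>t. D (t *\<^sub>R axis j 1))) (at 0)"
    using has_derivative_compose[where g = f] assms by fastforce
  moreover have "D (t *\<^sub>R axis j 1) = t *\<^sub>R D (axis j 1)" for t
    using assms has_derivative_linear linear_cmul by blast
  ultimately show ?thesis by (simp add: has_vector_derivative_def)
qed

lemma partial_deriv_eqI:
  fixes f :: "real ^ 'd::finite \<Rightarrow> complex"
  assumes "(f has_derivative D) (at x)"
  shows "partial_deriv j f x = D (axis j 1)"
  unfolding partial_deriv_def using has_partial_derivI[OF assms] by (rule vector_derivative_at)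

lemma smooth_has_partial_deriv:
  assumes "smooth f"
  shows "((\<lambda>t. f (x + t *\<^sub>R axis j 1)) has_vector_derivative partial_deriv j f x) (at 0)"
proof -
  obtain D where "(f has_derivative D) (at x)"
    using smooth_differentiable[OF assms] unfolding differentiable_def by blast
  then show ?thesis using has_partial_derivI partial_deriv_eqI by metis
qed

lemma partial_deriv_lincomb:
  fixes f g :: "real ^ 'd::finite \<Rightarrow> complex"
  assumes "\<And>x. f differentiable (at x)" "\<And>x. g differentiable (at x)"
  shows "partial_deriv j (\<lambda>x. c * f x + g x) = (\<lambda>x. c * partial_deriv j f x + partial_deriv j g x)"
proof
  fix x
  obtain D E where D: "(f has_derivative D) (at x)" and E: "(g has_derivative E) (at x)"
    using assms unfolding differentiable_def by blast
  have "((\<lambda>x. c * f x + g x) has_derivative (\<lambda>h. c * D h + E h)) (at x)"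
    using D E by (auto intro!: derivative_eq_intros)
  then show "partial_deriv j (\<lambda>x. c * f x + g x) x = c * partial_deriv j f x + partial_deriv j g x"
    using D E by (simp add: partial_deriv_eqI)
qed

lemma C_k_lincomb: "C_k k f \<Longrightarrow> C_k k g \<Longrightarrow> C_k k (\<lambda>x. c * f x + g x)"
proof (induction k arbitrary: f g)
  case 0
  then show ?case by (auto intro!: continuous_intros)
next
  case (Suc k)
  then have "\<And>x. f differentiable (at x)" "\<And>x. g differentiable (at x)" by auto
  then show ?case
    using Suc by (auto simp: partial_deriv_lincomb)
qed

lemma smooth_lincomb: "smooth f \<Longrightarrow> smooth g \<Longrightarrow> smooth (\<lambda>x. c * f x + g x)"
  unfolding smooth_def using C_k_lincomb by blast

lemma periodic_partial_deriv:
  assumes "periodic f"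
  shows "periodic (partial_deriv j f)"
proof -
  have "f (x + axis i (2 * pi) + t *\<^sub>R axis j 1) = f (x + t *\<^sub>R axis j 1)" for x i t
    using assms unfolding periodic_def
    by (simp add: add.assoc add.commute[of "axis i (2 * pi)"]) (simp flip: add.assoc)
  then show ?thesis by (simp add: periodic_def partial_deriv_def)
qed

lemma multi_power_invariant:
  assumes "\<And>j g. Q g \<Longrightarrow> Q (D j g)" "Q g"
  shows "Q (multi_power D \<alpha> g)"
proof -
  have pow: "Q ((D j ^^ k) g)" if "Q g" for j k g
    using that by (induction k) (auto intro: assms(1))
  have "Q (foldr (\<lambda>j. D j ^^ (\<alpha> $ j)) js g)" for js
    by (induction js) (auto intro: pow assms(2))
  then show ?thesis by (simp add: multi_power_def)
qed

text \<open>Any correspondence that single operators respect passes to their multi-index powers. It is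
  used below to read derivatives of a Fourier series off its coefficients.\<close>
lemma multi_power_rel:
  assumes "\<And>j g h. R g h \<Longrightarrow> R (D j g) (E j h)" "R g h"
  shows "R (multi_power D \<alpha> g) (multi_power E \<alpha> h)"
proof -
  have pow: "R ((D j ^^ k) g) ((E j ^^ k) h)" if "R g h" for j k g h
    using that by (induction k) (auto intro: assms(1))
  have "R (foldr (\<lambda>j. D j ^^ (\<alpha> $ j)) js g) (foldr (\<lambda>j. E j ^^ (\<alpha> $ j)) js h)" for js
    by (induction js) (auto intro: pow assms(2))
  then show ?thesis by (simp add: multi_power_def)
qed

lemma smooth_multi_deriv: "smooth f \<Longrightarrow> smooth (multi_deriv \<beta> f)"
  by (rule multi_power_invariant[where Q = smooth]) (auto intro: smooth_partial_deriv)

lemma periodic_multi_deriv: "periodic f \<Longrightarrow> periodic (multi_deriv \<beta> f)"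
  by (rule multi_power_invariant[where Q = periodic]) (auto intro: periodic_partial_deriv)

lemma multi_deriv_lincomb:
  assumes "smooth f" "smooth g"
  shows "multi_deriv \<beta> (\<lambda>x. c * f x + g x) = (\<lambda>x. c * multi_deriv \<beta> f x + multi_deriv \<beta> g x)"
proof -
  \<comment> \<open>\<open>R\<close> relates a linear combination to the pair of its two parts, on which \<open>E\<close> acts
    componentwise.\<close>
  define R :: "(real ^ 'a \<Rightarrow> complex) \<Rightarrow>
      (real ^ 'a \<Rightarrow> complex) \<times> (real ^ 'a \<Rightarrow> complex) \<Rightarrow> bool" where
    "R h p \<longleftrightarrow> smooth (fst p) \<and> smooth (snd p) \<and> h = (\<lambda>x. c * fst p x + snd p x)" for h p
  define E :: "'a \<Rightarrow> (real ^ 'a \<Rightarrow> complex) \<times> (real ^ 'a \<Rightarrow> complex) \<Rightarrow>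
      (real ^ 'a \<Rightarrow> complex) \<times> (real ^ 'a \<Rightarrow> complex)" where
    "E j p = (partial_deriv j (fst p), partial_deriv j (snd p))" for j p
  have step: "R (partial_deriv j h) (E j p)" if "R h p" for j h p
    using that by (auto simp: R_def E_def partial_deriv_lincomb smooth_partial_deriv smooth_differentiable)
  have "R (multi_deriv \<beta> (\<lambda>x. c * f x + g x)) (multi_power E \<beta> (f, g))"
    by (rule multi_power_rel[where R = R]) (use assms step in \<open>auto simp: R_def\<close>)
  moreover have "fst (multi_power E \<beta> (f, g)) = multi_deriv \<beta> f"
    using multi_power_rel[where R = "\<lambda>p h. fst p = h" and D = E and E = partial_deriv and \<alpha> = \<beta>
        and g = "(f, g)" and h = f] by (simp add: E_def)
  moreover have "snd (multi_power E \<beta> (f, g)) = multi_deriv \<beta> g"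
    using multi_power_rel[where R = "\<lambda>p h. snd p = h" and D = E and E = partial_deriv and \<alpha> = \<beta>
        and g = "(f, g)" and h = g] by (simp add: E_def)
  ultimately show ?thesis by (simp add: R_def)
qed

lemma coords: "distinct (coords :: 'd::finite list)" "set (coords :: 'd list) = UNIV"
proof -
  have "\<exists>js::'d list. distinct js \<and> set js = UNIV" using finite_distinct_list[of "UNIV :: 'd set"] by auto
  from someI_ex[OF this] show "distinct (coords :: 'd list)" "set (coords :: 'd list) = UNIV"
    unfolding coords_def by auto
qed

text \<open>The order in which the coordinates are listed does not matter here, because all but one of
  the factors are identities.\<close>
lemma multi_power_axis: "multi_power D (axis j k) g = (D j ^^ k) g"
proof -
  have "distinct js \<Longrightarrow> foldr (\<lambda>i. D i ^^ (axis j k $ i)) js g = (if j \<in> set js then (D j ^^ k) g else g)" for js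
    by (induction js) (auto simp: axis_def)
  from this[OF coords(1)] show ?thesis by (simp add: multi_power_def coords(2))
qed

lemma multi_power_zero:
  fixes D :: "'d::finite \<Rightarrow> 'g \<Rightarrow> 'g"
  shows "multi_power D 0 g = g"
proof -
  have "foldr (\<lambda>i. D i ^^ ((0::nat^'d) $ i)) js g = g" for js
    by (induction js) auto
  then show ?thesis by (simp add: multi_power_def)
qed

lemma periodic_int_shift:
  fixes f :: "real ^ 'd::finite \<Rightarrow> complex"
  assumes "periodic f"
  shows "f (x + (\<chi> j. 2 * pi * of_int (k $ j))) = f x"
proof -
  have nat: "f (x + axis j (2 * pi * of_nat l)) = f x" for j l x
  proof (induction l)
    case 0
    have "axis j 0 = (0 :: real ^ 'd)" by (simp add: axis_def vec_eq_iff)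
    then show ?case by (simp only: of_nat_0 mult_zero_right add_0_right)
  next
    case (Suc l)
    have "x + axis j (2 * pi * of_nat (Suc l)) = (x + axis j (2 * pi * of_nat l)) + axis j (2 * pi)"
      by (simp add: axis_def vec_eq_iff algebra_simps)
    then show ?case using assms Suc unfolding periodic_def by metis
  qed
  have int: "f (x + axis j (2 * pi * of_int l)) = f x" for j l x
  proof (cases "0 \<le> l")
    case True
    then show ?thesis using nat[of x j "nat l"] by simp
  next
    case False
    have "x + axis j (2 * pi * of_int l) + axis j (2 * pi * of_nat (nat (- l))) = x"
      using False by (simp add: axis_def vec_eq_iff)
    then show ?thesis using nat[of "x + axis j (2 * pi * of_int l)" j "nat (- l)"] by metis
  qed
  have "f (x + (\<Sum>j\<in>A. axis j (2 * pi * of_int (k $ j)))) = f x" if "finite A" for A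
    using that
  proof (induction A)
    case (insert j A)
    then show ?case
      using int[of "x + (\<Sum>j\<in>A. axis j (2 * pi * of_int (k $ j)))" j "k $ j"] by (simp add: add.commute add.left_commute)
  qed simp
  from this[of UNIV] have "f (x + (\<Sum>j\<in>UNIV. axis j (2 * pi * of_int (k $ j)))) = f x" by simp
  moreover have "(\<Sum>j\<in>UNIV. axis j (2 * pi * of_int (k $ j))) = (\<chi> j. 2 * pi * of_int (k $ j))"
    by (simp add: vec_eq_iff axis_def)
  ultimately show ?thesis by simp
qed

lemma continuous_periodic_bounded:
  assumes "continuous_on UNIV f" "periodic f"
  shows "bdd_above (range (\<lambda>x. norm (f x)))"
proof -
  have "compact (f ` cbox 0 (\<chi> j. 2 * pi))"
    using assms(1) by (intro compact_continuous_image compact_cbox continuous_on_subset[OF assms(1)]) auto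
  then obtain B where B: "\<And>y. y \<in> cbox 0 (\<chi> j. 2 * pi) \<Longrightarrow> norm (f y) \<le> B"
    by (meson bounded_iff compact_imp_bounded imageI)
  have "norm (f x) \<le> B" for x
  proof -
    \<comment> \<open>Subtracting the integer part of \<open>x / (2 \<pi>)\<close> coordinatewise moves \<open>x\<close> into the period cube.\<close>
    define y :: "real ^ 'a" where "y = x + (\<chi> j. 2 * pi * of_int ((\<chi> j. - \<lfloor>x $ j / (2 * pi)\<rfloor>) $ j))"
    have "y $ j = 2 * pi * frac (x $ j / (2 * pi))" for j
      by (simp add: y_def frac_def algebra_simps)
    then have "y \<in> cbox 0 (\<chi> j. 2 * pi)"
      by (auto simp: mem_box_cart less_imp_le[OF frac_lt_1])
    then show ?thesis using B periodic_int_shift[OF assms(2)] unfolding y_def by metis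
  qed
  then show ?thesis by (auto simp: bdd_above_def)
qed

lemma test_functionsD: "\<phi> \<in> test_functions \<Longrightarrow> smooth \<phi>" "\<phi> \<in> test_functions \<Longrightarrow> periodic \<phi>"
  by (auto simp: test_functions_def)

lemma test_functions_lincomb:
  "\<phi> \<in> test_functions \<Longrightarrow> \<psi> \<in> test_functions \<Longrightarrow> (\<lambda>x. c * \<phi> x + \<psi> x) \<in> test_functions"
  by (auto simp: test_functions_def smooth_lincomb periodic_def)

lemma zero_test_function: "(\<lambda>x. 0) \<in> test_functions"
proof -
  have "C_k k (\<lambda>x::real^'a. 0::complex)" for k
    by (induction k) (auto simp: partial_deriv_def)
  then show ?thesis by (simp add: test_functions_def smooth_def periodic_def)
qed

lemma test_functions_cmult: "\<phi> \<in> test_functions \<Longrightarrow> (\<lambda>x. c * \<phi> x) \<in> test_functions"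
  using test_functions_lincomb[OF _ zero_test_function] by simp

lemma test_functions_add:
  "\<phi> \<in> test_functions \<Longrightarrow> \<psi> \<in> test_functions \<Longrightarrow> (\<lambda>x. \<phi> x + \<psi> x) \<in> test_functions"
  using test_functions_lincomb[of \<phi> \<psi> 1] by simp

lemma test_functions_diff:
  "\<phi> \<in> test_functions \<Longrightarrow> \<psi> \<in> test_functions \<Longrightarrow> \<phi> - \<psi> \<in> test_functions"
  using test_functions_lincomb[of \<psi> \<phi> "-1"] by (simp add: fun_diff_def)

section \<open>The seminorms of the test functions\<close>

lemma multi_deriv_le_test_seminorm:
  assumes "\<phi> \<in> test_functions"
  shows "norm (multi_deriv \<beta> \<phi> x) \<le> test_seminorm \<beta> \<phi>"
  unfolding test_seminorm_def
  by (rule cSUP_upper, simp, rule continuous_periodic_bounded)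
     (use assms in \<open>auto simp: test_functions_def intro: smooth_continuous smooth_multi_deriv periodic_multi_deriv\<close>)

lemma test_seminorm_nonneg: "\<phi> \<in> test_functions \<Longrightarrow> 0 \<le> test_seminorm \<beta> \<phi>"
  using multi_deriv_le_test_seminorm norm_ge_zero order_trans by blast

lemma test_seminorm_leI: "(\<And>x. norm (multi_deriv \<beta> \<phi> x) \<le> B) \<Longrightarrow> test_seminorm \<beta> \<phi> \<le> B"
  unfolding test_seminorm_def by (rule cSUP_least) auto

lemma test_seminorm_lincomb:
  assumes "\<phi> \<in> test_functions" "\<psi> \<in> test_functions"
  shows "test_seminorm \<beta> (\<lambda>x. c * \<phi> x + \<psi> x) \<le> norm c * test_seminorm \<beta> \<phi> + test_seminorm \<beta> \<psi>"
proof (rule test_seminorm_leI)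
  fix x
  have "norm (multi_deriv \<beta> (\<lambda>x. c * \<phi> x + \<psi> x) x) \<le> norm c * norm (multi_deriv \<beta> \<phi> x) + norm (multi_deriv \<beta> \<psi> x)"
    using assms by (simp add: multi_deriv_lincomb test_functionsD) (metis norm_mult norm_triangle_ineq)
  also have "\<dots> \<le> norm c * test_seminorm \<beta> \<phi> + test_seminorm \<beta> \<psi>"
    using assms by (intro add_mono mult_left_mono multi_deriv_le_test_seminorm) auto
  finally show "norm (multi_deriv \<beta> (\<lambda>x. c * \<phi> x + \<psi> x) x) \<le> norm c * test_seminorm \<beta> \<phi> + test_seminorm \<beta> \<psi>" .
qed

lemma test_seminorm_zero: "test_seminorm \<beta> (\<lambda>x. 0) = 0"
proof -
  have "multi_deriv \<beta> (\<lambda>x. 0) = (\<lambda>x. 0)"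
    using multi_deriv_lincomb[of "\<lambda>x. 0" "\<lambda>x. 0" \<beta> "-1"] test_functionsD(1)[OF zero_test_function]
    by simp
  then show ?thesis by (simp add: test_seminorm_def)
qed

lemma test_seminorm_cmult:
  "\<phi> \<in> test_functions \<Longrightarrow> test_seminorm \<beta> (\<lambda>x. c * \<phi> x) \<le> norm c * test_seminorm \<beta> \<phi>"
  using test_seminorm_lincomb[OF _ zero_test_function, of \<phi> \<beta> c] by (simp add: test_seminorm_zero)

section \<open>Distributions as functionals of finite order\<close>

lemma openin_test_topology_iff:
  "openin test_topology U \<longleftrightarrow> U \<subseteq> test_functions \<and>
     (\<forall>\<phi>\<in>U. \<exists>F e. finite F \<and> F \<subseteq> range test_seminorm \<and> 0 < e \<and> seminorm_ball test_functions F \<phi> e \<subseteq> U)"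
  unfolding test_topology_def
proof (rule openin_seminorm_topology_iff)
  fix p :: "(real ^ 'a \<Rightarrow> complex) \<Rightarrow> real" and x y z :: "real ^ 'a \<Rightarrow> complex"
  assume "p \<in> range test_seminorm" "x \<in> test_functions"
  then show "p (x - x) = 0" by (auto simp: test_seminorm_zero fun_diff_def)
  assume "y \<in> test_functions" "z \<in> test_functions"
  then show "p (x - z) \<le> p (x - y) + p (y - z)"
    using \<open>p \<in> range test_seminorm\<close> \<open>x \<in> test_functions\<close>
      test_seminorm_lincomb[OF test_functions_diff[of x y] test_functions_diff[of y z], of _ 1]
    by (auto simp: fun_diff_def)
qed auto

lemma topspace_test_topology: "topspace test_topology = test_functions"
  unfolding test_topology_def
proof (rule topspace_seminorm_topology)
  fix p :: "(real ^ 'a \<Rightarrow> complex) \<Rightarrow> real" and x :: "real ^ 'a \<Rightarrow> complex"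
  assume "p \<in> range test_seminorm" "x \<in> test_functions"
  then show "p (x - x) = 0" by (auto simp: test_seminorm_zero fun_diff_def)
qed auto

lemma distribution_add:
  "u \<in> distributions \<Longrightarrow> \<phi> \<in> test_functions \<Longrightarrow> \<psi> \<in> test_functions \<Longrightarrow> u (\<lambda>x. \<phi> x + \<psi> x) = u \<phi> + u \<psi>"
  by (auto simp: distributions_def)

lemma distribution_cmult:
  "u \<in> distributions \<Longrightarrow> \<phi> \<in> test_functions \<Longrightarrow> u (\<lambda>x. c * \<phi> x) = c * u \<phi>"
  by (auto simp: distributions_def)

lemma distribution_zero: "u \<in> distributions \<Longrightarrow> u (\<lambda>x. 0) = 0"
  using distribution_cmult[OF _ zero_test_function, of u 0] by simp

text \<open>Some basic neighbourhood of zero is mapped into the unit ball, and homogeneity turns this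
  into an estimate for all test functions.\<close>
lemma distribution_bound:
  fixes u :: "(real ^ 'd::finite \<Rightarrow> complex) \<Rightarrow> complex"
  assumes u: "u \<in> distributions"
  obtains C B where "finite B" "0 \<le> C"
    "\<And>\<phi>. \<phi> \<in> test_functions \<Longrightarrow> norm (u \<phi>) \<le> C * (\<Sum>\<beta>\<in>B. test_seminorm \<beta> \<phi>)"
proof -
  let ?U = "{\<phi> \<in> test_functions. u \<phi> \<in> ball 0 1}"
  have U: "openin test_topology ?U"
    using u openin_continuous_map_preimage[of test_topology euclidean u "ball 0 1"]
    by (auto simp: distributions_def topspace_test_topology)
  have zero: "(\<lambda>x. 0) \<in> ?U" using distribution_zero[OF u] zero_test_function by simp
  obtain F e where F: "finite F" "F \<subseteq> range test_seminorm" "0 < e"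
      "seminorm_ball test_functions F (\<lambda>x. 0) e \<subseteq> ?U"
    using bspec[OF conjunct2[OF U[unfolded openin_test_topology_iff]] zero]
    by (elim exE conjE) (rule that)
  obtain B where B: "finite B" "F = test_seminorm ` B"
    using finite_subset_image[OF F(1,2)] by blast
  have "norm (u \<phi>) \<le> 2 / e * (\<Sum>\<beta>\<in>B. test_seminorm \<beta> \<phi>)" if \<phi>: "\<phi> \<in> test_functions" for \<phi>
  proof (rule field_le_epsilon)
    fix \<epsilon> :: real assume "0 < \<epsilon>"
    let ?N = "\<Sum>\<beta>\<in>B. test_seminorm \<beta> \<phi>"
    \<comment> \<open>The summand with \<open>\<epsilon>\<close> keeps the scaling factor finite when all the seminorms vanish.\<close>
    define t where "t = 2 / e * ?N + \<epsilon>"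
    have N: "0 \<le> ?N" using \<phi> by (intro sum_nonneg test_seminorm_nonneg)
    have "0 < t" using N \<open>0 < e\<close> \<open>0 < \<epsilon>\<close> by (simp add: t_def add_nonneg_pos)
    let ?\<psi> = "\<lambda>x. complex_of_real (1 / t) * \<phi> x"
    have "test_seminorm \<beta> ?\<psi> < e" if "\<beta> \<in> B" for \<beta>
    proof -
      have "test_seminorm \<beta> ?\<psi> \<le> 1 / t * test_seminorm \<beta> \<phi>"
        using test_seminorm_cmult[OF \<phi>, of \<beta> "complex_of_real (1 / t)"] \<open>0 < t\<close>
        by (simp add: norm_divide)
      also have "\<dots> \<le> 1 / t * ?N"
        using that \<open>0 < t\<close> \<phi> \<open>finite B\<close>
        by (intro mult_left_mono member_le_sum test_seminorm_nonneg) auto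
      also have "\<dots> < e"
      proof -
        have "e * t = 2 * ?N + e * \<epsilon>" using \<open>0 < e\<close> by (simp add: t_def field_simps)
        moreover have "0 < e * \<epsilon>" using \<open>0 < e\<close> \<open>0 < \<epsilon>\<close> by simp
        ultimately have "?N < e * t" using N by linarith
        then show ?thesis using \<open>0 < t\<close> by (simp add: field_simps)
      qed
      finally show ?thesis .
    qed
    then have "?\<psi> \<in> seminorm_ball test_functions F (\<lambda>x. 0) e"
      using test_functions_cmult[OF \<phi>, of "complex_of_real (1 / t)"]
      by (auto simp: seminorm_ball_def B(2) fun_diff_def)
    then have "norm (u ?\<psi>) < 1" using F(4) by auto
    then have "norm (u \<phi>) < t"
      unfolding distribution_cmult[OF u \<phi>] using \<open>0 < t\<close>
      by (simp add: norm_mult norm_divide field_simps)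
    then show "norm (u \<phi>) \<le> 2 / e * ?N + \<epsilon>" by (simp add: t_def)
  qed
  then show ?thesis using that[OF B(1), of "2 / e"] \<open>0 < e\<close> by auto
qed

lemma distributionI:
  fixes u :: "(real ^ 'd::finite \<Rightarrow> complex) \<Rightarrow> complex"
  assumes "u \<in> extensional test_functions"
    and add: "\<And>\<phi> \<psi>. \<phi> \<in> test_functions \<Longrightarrow> \<psi> \<in> test_functions \<Longrightarrow> u (\<lambda>x. \<phi> x + \<psi> x) = u \<phi> + u \<psi>"
    and cmult: "\<And>c \<phi>. \<phi> \<in> test_functions \<Longrightarrow> u (\<lambda>x. c * \<phi> x) = c * u \<phi>"
    and "finite B" "0 \<le> C"
    and bound: "\<And>\<phi>. \<phi> \<in> test_functions \<Longrightarrow> norm (u \<phi>) \<le> C * (\<Sum>\<beta>\<in>B. test_seminorm \<beta> \<phi>)"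
  shows "u \<in> distributions"
proof -
  have diff: "u \<phi> - u \<psi> = u (\<phi> - \<psi>)" if "\<phi> \<in> test_functions" "\<psi> \<in> test_functions" for \<phi> \<psi>
    using add[OF test_functions_diff[OF that] that(2)] by (simp add: fun_diff_def)
  have "continuous_map test_topology euclidean u"
    unfolding continuous_map_def topspace_test_topology
  proof (intro conjI allI impI)
    fix U :: "complex set" assume "openin euclidean U"
    then have "open U" by simp
    show "openin test_topology {\<phi> \<in> test_functions. u \<phi> \<in> U}"
      unfolding openin_test_topology_iff
    proof (intro conjI ballI)
      fix \<phi> assume "\<phi> \<in> {\<phi> \<in> test_functions. u \<phi> \<in> U}"
      then have \<phi>: "\<phi> \<in> test_functions" "u \<phi> \<in> U" by auto
      obtain r where r: "0 < r" "ball (u \<phi>) r \<subseteq> U" using \<phi>(2) \<open>open U\<close> openE by blast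
      define e where "e = r / (C * card B + 1)"
      have den: "0 < C * card B + 1" using \<open>0 \<le> C\<close> by (simp add: add_nonneg_pos)
      have "u \<psi> \<in> U" if "\<psi> \<in> seminorm_ball test_functions (test_seminorm ` B) \<phi> e" for \<psi>
      proof -
        have \<psi>: "\<psi> \<in> test_functions" "\<And>\<beta>. \<beta> \<in> B \<Longrightarrow> test_seminorm \<beta> (\<psi> - \<phi>) \<le> e"
          using that by (auto simp: seminorm_ball_def)
        have "norm (u \<psi> - u \<phi>) \<le> C * (\<Sum>\<beta>\<in>B. test_seminorm \<beta> (\<psi> - \<phi>))"
          using bound[OF test_functions_diff[OF \<psi>(1) \<phi>(1)]] diff[OF \<psi>(1) \<phi>(1)] by simp
        also have "\<dots> \<le> C * (card B * e)"
          using \<psi>(2) \<open>0 \<le> C\<close> by (intro mult_left_mono sum_bounded_above) auto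
        also have "\<dots> < r"
          using den \<open>0 < r\<close> by (simp add: e_def field_simps)
        finally show ?thesis using r(2) by (auto simp: dist_norm norm_minus_commute)
      qed
      moreover have "0 < e" using r den by (simp add: e_def)
      ultimately show "\<exists>F e. finite F \<and> F \<subseteq> range test_seminorm \<and> 0 < e \<and>
          seminorm_ball test_functions F \<phi> e \<subseteq> {\<phi> \<in> test_functions. u \<phi> \<in> U}"
        using \<open>finite B\<close> by (intro exI[of _ "test_seminorm ` B"] exI[of _ e])
          (auto simp: seminorm_ball_def)
    qed auto
  qed auto
  then show ?thesis using assms(1) add cmult by (simp add: distributions_def)
qed

text \<open>Because of this the suprema that define the strong seminorms are suprema of bounded sets; without
  it the supremum would be an unspecified real number and the triangle inequality would be lost.\<close>
lemma distribution_bounded_on: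
  assumes "u \<in> distributions" "B \<in> bounded_test_sets"
  shows "bdd_above ((\<lambda>\<phi>. norm (u \<phi>)) ` B)"
proof -
  obtain C F where F: "finite F" "0 \<le> C"
    "\<And>\<phi>. \<phi> \<in> test_functions \<Longrightarrow> norm (u \<phi>) \<le> C * (\<Sum>\<beta>\<in>F. test_seminorm \<beta> \<phi>)"
    by (rule distribution_bound[OF assms(1)]) (rule that)
  have "\<forall>\<beta>. \<exists>M. \<forall>\<phi>\<in>B. test_seminorm \<beta> \<phi> \<le> M"
    using assms(2) by (auto simp: bounded_test_sets_def bdd_above_def)
  then obtain M where M: "\<And>\<beta> \<phi>. \<phi> \<in> B \<Longrightarrow> test_seminorm \<beta> \<phi> \<le> M \<beta>" by metis
  have "norm (u \<phi>) \<le> C * (\<Sum>\<beta>\<in>F. M \<beta>)" if "\<phi> \<in> B" for \<phi>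
  proof -
    have "\<phi> \<in> test_functions" using that assms(2) by (auto simp: bounded_test_sets_def)
    then have "norm (u \<phi>) \<le> C * (\<Sum>\<beta>\<in>F. test_seminorm \<beta> \<phi>)" by (rule F(3))
    also have "\<dots> \<le> C * (\<Sum>\<beta>\<in>F. M \<beta>)"
      using M[OF that] F(2) by (intro mult_left_mono sum_mono)
    finally show ?thesis .
  qed
  then show ?thesis by (auto simp: bdd_above_def)
qed

section \<open>The topologies of the dual\<close>

abbreviation dual_seminorms :: "(((real ^ 'd::finite \<Rightarrow> complex) \<Rightarrow> complex) \<Rightarrow> real) set" where
  "dual_seminorms \<equiv> {\<lambda>u. SUP \<phi>\<in>B. norm (u \<phi>) | B. B \<in> bounded_test_sets}"

lemma dual_seminorm_self:
  assumes "p \<in> dual_seminorms"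
  shows "p (u - u) = 0"
proof -
  obtain B where "B \<in> bounded_test_sets" "p = (\<lambda>u. SUP \<phi>\<in>B. norm (u \<phi>))" using assms by blast
  then show ?thesis by (simp add: bounded_test_sets_def cSUP_const)
qed

lemma dual_seminorms_nonempty: "dual_seminorms \<noteq> {}"
proof -
  have "{\<lambda>x. 0} \<in> bounded_test_sets"
    by (simp add: bounded_test_sets_def zero_test_function)
  then show ?thesis by blast
qed

lemma dual_seminorm_triangle:
  assumes "p \<in> dual_seminorms" "u \<in> distributions" "v \<in> distributions" "w \<in> distributions"
  shows "p (u - w) \<le> p (u - v) + p (v - w)"
proof -
  obtain B where B: "B \<in> bounded_test_sets" "p = (\<lambda>u. SUP \<phi>\<in>B. norm (u \<phi>))" using assms(1) by blast
  have bdd: "bdd_above ((\<lambda>\<phi>. norm ((s - t) \<phi>)) ` B)"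
    if st: "s \<in> distributions" "t \<in> distributions" for s t
  proof -
    obtain M N where "\<And>\<phi>. \<phi> \<in> B \<Longrightarrow> norm (s \<phi>) \<le> M" "\<And>\<phi>. \<phi> \<in> B \<Longrightarrow> norm (t \<phi>) \<le> N"
      using distribution_bounded_on[OF st(1) B(1)] distribution_bounded_on[OF st(2) B(1)]
      by (auto simp: bdd_above_def)
    then have "norm ((s - t) \<phi>) \<le> M + N" if "\<phi> \<in> B" for \<phi>
      using norm_triangle_le_diff[of "s \<phi>" "t \<phi>" "M + N"] that by (simp add: add_mono)
    then show ?thesis by (auto simp: bdd_above_def)
  qed
  show ?thesis unfolding B(2)
  proof (rule cSUP_least)
    show "B \<noteq> {}" using B(1) by (simp add: bounded_test_sets_def)
    fix \<phi> assume "\<phi> \<in> B"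
    have "norm ((u - w) \<phi>) \<le> norm ((u - v) \<phi>) + norm ((v - w) \<phi>)"
      using norm_triangle_ineq[of "(u - v) \<phi>" "(v - w) \<phi>"] by simp
    also have "\<dots> \<le> (SUP \<phi>\<in>B. norm ((u - v) \<phi>)) + (SUP \<phi>\<in>B. norm ((v - w) \<phi>))"
      using assms \<open>\<phi> \<in> B\<close> by (intro add_mono cSUP_upper bdd)
    finally show "norm ((u - w) \<phi>) \<le> (SUP \<phi>\<in>B. norm ((u - v) \<phi>)) + (SUP \<phi>\<in>B. norm ((v - w) \<phi>))" .
  qed
qed

lemma topspace_strong_dual_topology: "topspace strong_dual_topology = distributions"
  unfolding strong_dual_topology_def
  by (rule topspace_seminorm_topology[OF dual_seminorms_nonempty]) (rule dual_seminorm_self)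

lemma openin_strong_dual_topology_iff:
  "openin strong_dual_topology U \<longleftrightarrow> U \<subseteq> distributions \<and>
     (\<forall>u\<in>U. \<exists>F e. finite F \<and> F \<subseteq> dual_seminorms \<and> 0 < e \<and> seminorm_ball distributions F u e \<subseteq> U)"
  unfolding strong_dual_topology_def
  by (rule openin_seminorm_topology_iff[OF dual_seminorms_nonempty])
    (rule dual_seminorm_self, assumption, rule dual_seminorm_triangle)

lemma topspace_weak_star_topology: "topspace weak_star_topology = distributions"
  by (auto simp: weak_star_topology_def distributions_def PiE_UNIV_domain PiE_def)

text \<open>Precomposition with a map \<open>G\<close> that preserves bounded sets pulls evaluation at \<open>\<phi>\<close> back to evaluation at
  \<open>G \<phi>\<close>, and the seminorm of a bounded set \<open>B\<close> to that of \<open>G ` B\<close>; this yields continuity for the weak-star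
  and the strong topology, respectively.\<close>
lemma continuous_map_transpose:
  fixes A :: "((real ^ 'd::finite \<Rightarrow> complex) \<Rightarrow> complex) \<Rightarrow> ((real ^ 'd \<Rightarrow> complex) \<Rightarrow> complex)"
  assumes A: "\<And>u. u \<in> distributions \<Longrightarrow> A u \<in> distributions"
    and G: "\<And>\<phi>. \<phi> \<in> test_functions \<Longrightarrow> G \<phi> \<in> test_functions"
    and AG: "\<And>u \<phi>. u \<in> distributions \<Longrightarrow> \<phi> \<in> test_functions \<Longrightarrow> A u \<phi> = u (G \<phi>)"
    and bounded: "\<And>B. B \<in> bounded_test_sets \<Longrightarrow> G ` B \<in> bounded_test_sets"
    and T: "T \<in> {strong_dual_topology, weak_star_topology}"
  shows "continuous_map T T A"
proof (cases "T = weak_star_topology")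
  case True
  have "continuous_map weak_star_topology euclidean (\<lambda>u. A u \<phi>)" if "\<phi> \<in> test_functions" for \<phi>
  proof (rule continuous_map_eq)
    show "continuous_map weak_star_topology euclidean (\<lambda>u. u (G \<phi>))"
      unfolding weak_star_topology_def
      by (intro continuous_map_from_subtopology) (rule continuous_map_product_projection[OF G[OF that]])
  qed (use AG that in \<open>simp add: topspace_weak_star_topology\<close>)
  moreover have "A u \<in> extensional test_functions" if "u \<in> distributions" for u
    using A[OF that] by (simp add: distributions_def)
  ultimately show ?thesis
    unfolding True by (subst (2) weak_star_topology_def)
      (auto simp: continuous_map_in_subtopology continuous_map_componentwise topspace_weak_star_topology A)
next
  case False
  with T have T: "T = strong_dual_topology" by simp
  have pull: "\<exists>q. q \<in> dual_seminorms \<and> (\<forall>u\<in>distributions. \<forall>v\<in>distributions. p (A u - A v) = q (u - v))"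
    if p: "p \<in> dual_seminorms" for p
  proof -
    obtain B where B: "B \<in> bounded_test_sets" "p = (\<lambda>u. SUP \<phi>\<in>B. norm (u \<phi>))" using p by blast
    have sub: "B \<subseteq> test_functions" using B(1) by (simp add: bounded_test_sets_def)
    have "p (A u - A v) = (SUP \<phi>\<in>G ` B. norm ((u - v) \<phi>))"
      if "u \<in> distributions" "v \<in> distributions" for u v
      unfolding B(2) image_image using sub that by (intro SUP_cong) (auto simp: AG)
    then show ?thesis using bounded[OF B(1)] by (intro exI[of _ "\<lambda>u. SUP \<phi>\<in>G ` B. norm (u \<phi>)"]) blast
  qed
  show ?thesis unfolding T continuous_map_def topspace_strong_dual_topology
  proof (intro conjI allI impI)
    fix U :: "((real ^ 'd \<Rightarrow> complex) \<Rightarrow> complex) set"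
    assume U: "openin strong_dual_topology U"
    show "openin strong_dual_topology {u \<in> distributions. A u \<in> U}"
      unfolding openin_strong_dual_topology_iff
    proof (intro conjI ballI)
      fix u assume "u \<in> {u \<in> distributions. A u \<in> U}"
      then have u: "u \<in> distributions" "A u \<in> U" by auto
      obtain F e where F: "finite F" "F \<subseteq> dual_seminorms" "0 < e"
          "seminorm_ball distributions F (A u) e \<subseteq> U"
        using bspec[OF conjunct2[OF U[unfolded openin_strong_dual_topology_iff]] u(2)]
        by (elim exE conjE) (rule that)
      have "\<forall>p\<in>F. \<exists>q. q \<in> dual_seminorms \<and>
          (\<forall>u\<in>distributions. \<forall>v\<in>distributions. p (A u - A v) = q (u - v))"
        by (intro ballI pull subsetD[OF F(2)])
      then obtain Q where Q: "\<forall>p\<in>F. Q p \<in> dual_seminorms \<and>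
          (\<forall>u\<in>distributions. \<forall>v\<in>distributions. p (A u - A v) = Q p (u - v))"
        unfolding bchoice_iff by blast
      show "\<exists>F e. finite F \<and> F \<subseteq> dual_seminorms \<and> 0 < e \<and>
          seminorm_ball distributions F u e \<subseteq> {u \<in> distributions. A u \<in> U}"
      proof (intro exI conjI)
        show "finite (Q ` F)" "0 < e" using F(1,3) by auto
        show "Q ` F \<subseteq> dual_seminorms" using Q by (intro image_subsetI) (drule (1) bspec, erule conjunct1)
        show "seminorm_ball distributions (Q ` F) u e \<subseteq> {u \<in> distributions. A u \<in> U}"
        proof
          fix v assume "v \<in> seminorm_ball distributions (Q ` F) u e"
          then have v: "v \<in> distributions" "\<And>p. p \<in> F \<Longrightarrow> Q p (v - u) < e"
            by (auto simp: seminorm_ball_def)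
          have "p (A v - A u) < e" if "p \<in> F" for p
            using bspec[OF Q that] u(1) v(1) v(2)[OF that] by simp
          then have "A v \<in> seminorm_ball distributions F (A u) e"
            using A v(1) by (simp add: seminorm_ball_def)
          then have "A v \<in> U" by (rule subsetD[OF F(4)])
          with v(1) show "v \<in> {u \<in> distributions. A u \<in> U}" by (intro CollectI conjI)
        qed
      qed
    qed auto
  qed (use A in auto)
qed

section \<open>Characters\<close>

lemma real_vec_nth [simp]: "real_vec n $ j = of_int (n $ j)"
  by (simp add: real_vec_def)

lemma real_vec_add: "real_vec (k + l) = real_vec k + real_vec l"
  by (simp add: vec_eq_iff)

lemma real_vec_uminus: "real_vec (- n) = - real_vec n"
  by (simp add: vec_eq_iff)

lemma norm_character [simp]: "norm (character n x) = 1"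
  by (simp add: character_def)

lemma character_mult: "character k x * character l x = character (k + l) x"
  by (simp add: character_def real_vec_add inner_add_left ring_distribs exp_add)

lemma character_add: "character n (x + y) = character n x * character n y"
  by (simp add: character_def inner_add_right ring_distribs exp_add)

lemma character_0 [simp]: "character 0 x = 1"
  by (simp add: character_def real_vec_def inner_vec_def)

lemma character_periodic: "periodic (character n)"
proof -
  have "character n (axis j (2 * pi)) = 1" for j
  proof -
    have "real_vec n \<bullet> axis j (2 * pi) = of_int (2 * (n $ j)) * pi"
      by (simp add: inner_axis)
    then show ?thesis unfolding character_def exp_eq_1 by auto
  qed
  then show ?thesis by (simp add: periodic_def character_add)
qed

text \<open>The exponent is purely imaginary, so the Taylor remainder of the exponential carries no
  exponential factor and the estimate is polynomial in \<open>n\<close>.\<close>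
lemma character_quadratic_remainder:
  "norm (character n h - 1 - \<i> * of_real (real_vec n \<bullet> h)) \<le> (norm (real_vec n) * norm h)\<^sup>2"
proof -
  let ?z = "\<i> * complex_of_real (real_vec n \<bullet> h)"
  have "norm (exp ?z - (\<Sum>k\<le>1. ?z ^ k / fact k)) \<le> exp \<bar>Re ?z\<bar> * norm ?z ^ Suc 1 / fact 1"
    by (rule Taylor_exp)
  then have "norm (exp ?z - 1 - ?z) \<le> \<bar>real_vec n \<bullet> h\<bar> ^ 2"
    by (simp add: norm_mult power2_eq_square algebra_simps)
  also have "\<dots> \<le> (norm (real_vec n) * norm h)\<^sup>2"
    by (intro power_mono Cauchy_Schwarz_ineq2) simp
  finally show ?thesis by (simp add: character_def)
qed

lemma bracket_ge_1: "1 \<le> bracket n"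
  by (simp add: bracket_def)

lemma bracket_pos: "0 < bracket n"
  using bracket_ge_1[of n] by linarith

lemma bracket_nonneg [simp]: "0 \<le> bracket n"
  using bracket_pos[of n] by simp

lemma norm_le_bracket: "norm (real_vec n) \<le> bracket n"
  unfolding bracket_def by (rule real_le_rsqrt) simp

lemma component_le_bracket: "\<bar>real_of_int (n $ j)\<bar> \<le> bracket n"
  using component_le_norm_cart[of "real_vec n" j] norm_le_bracket[of n] by simp

section \<open>Rapidly convergent Fourier series\<close>

text \<open>Summability for all \<open>k\<close> is equivalent to the usual boundedness for all \<open>k\<close>, and provides the
  majorants for the series below directly.\<close>
definition rapidly_decreasing :: "(int ^ 'd::finite \<Rightarrow> complex) \<Rightarrow> bool" where
  "rapidly_decreasing c \<longleftrightarrow> (\<forall>k. (\<lambda>n. bracket n ^ k * norm (c n)) summable_on UNIV)"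

text \<open>The sign of the frequency is chosen such that a distribution applied to the \<open>n\<close>-th term yields
  a multiple of its own \<open>n\<close>-th Fourier coefficient.\<close>
definition fourier_sum :: "(int ^ 'd::finite \<Rightarrow> complex) \<Rightarrow> real ^ 'd \<Rightarrow> complex" where
  "fourier_sum c x = (\<Sum>\<^sub>\<infinity>n. c n * character (- n) x)"

text \<open>The Fourier multiplier of \<open>partial_deriv j\<close> with respect to the characters of frequency \<open>- n\<close>.\<close>
definition deriv_coeff :: "'d::finite \<Rightarrow> (int ^ 'd \<Rightarrow> complex) \<Rightarrow> int ^ 'd \<Rightarrow> complex" where
  "deriv_coeff j c n = - \<i> * of_int (n $ j) * c n"

lemma rapidly_decreasing_weighted:
  "rapidly_decreasing c \<Longrightarrow> (\<lambda>n. bracket n ^ k * norm (c n)) summable_on UNIV"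
  by (simp add: rapidly_decreasing_def)

lemma rapidly_decreasing_abs_summable:
  "rapidly_decreasing c \<Longrightarrow> (\<lambda>n. norm (c n)) summable_on UNIV"
  using rapidly_decreasing_weighted[of c 0] by simp

lemma rapidly_decreasing_le:
  assumes "rapidly_decreasing c" "\<And>n. norm (d n) \<le> C * bracket n ^ l * norm (c n)"
  shows "rapidly_decreasing d"
  unfolding rapidly_decreasing_def
proof
  fix k
  have "(\<lambda>n. C * (bracket n ^ (k + l) * norm (c n))) summable_on UNIV"
    by (intro summable_on_cmult_right rapidly_decreasing_weighted assms(1))
  then show "(\<lambda>n. bracket n ^ k * norm (d n)) summable_on UNIV"
  proof (rule summable_on_comparison_test)
    fix n
    have "bracket n ^ k * norm (d n) \<le> bracket n ^ k * (C * bracket n ^ l * norm (c n))"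
      using bracket_pos[of n] by (intro mult_left_mono assms(2)) simp
    then show "bracket n ^ k * norm (d n) \<le> C * (bracket n ^ (k + l) * norm (c n))"
      by (simp add: power_add mult_ac)
    show "0 \<le> bracket n ^ k * norm (d n)" using bracket_pos[of n] by simp
  qed
qed

lemma norm_deriv_coeff_le: "norm (deriv_coeff j c n) \<le> bracket n * norm (c n)"
  unfolding deriv_coeff_def norm_mult
  using component_le_bracket[of n j] by (simp add: mult_right_mono)

lemma rapidly_decreasing_deriv_coeff: "rapidly_decreasing c \<Longrightarrow> rapidly_decreasing (deriv_coeff j c)"
  by (rule rapidly_decreasing_le[where C = 1 and l = 1]) (auto simp: norm_deriv_coeff_le)

lemma rapidly_decreasing_lincomb:
  assumes "rapidly_decreasing c" "rapidly_decreasing d"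
  shows "rapidly_decreasing (\<lambda>n. z * c n + d n)"
  unfolding rapidly_decreasing_def
proof
  fix k
  have "(\<lambda>n. norm z * (bracket n ^ k * norm (c n)) + bracket n ^ k * norm (d n)) summable_on UNIV"
    by (intro summable_on_add summable_on_cmult_right rapidly_decreasing_weighted assms)
  then show "(\<lambda>n. bracket n ^ k * norm (z * c n + d n)) summable_on UNIV"
  proof (rule summable_on_comparison_test)
    fix n
    have "norm (z * c n + d n) \<le> norm z * norm (c n) + norm (d n)"
      by (metis norm_mult norm_triangle_ineq)
    then have "bracket n ^ k * norm (z * c n + d n) \<le> bracket n ^ k * (norm z * norm (c n) + norm (d n))"
      using bracket_pos[of n] by (intro mult_left_mono) auto
    then show "bracket n ^ k * norm (z * c n + d n) \<le> norm z * (bracket n ^ k * norm (c n)) + bracket n ^ k * norm (d n)"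
      by (simp add: algebra_simps)
    show "0 \<le> bracket n ^ k * norm (z * c n + d n)" using bracket_pos[of n] by simp
  qed
qed

lemma fourier_sum_summable:
  "rapidly_decreasing c \<Longrightarrow> (\<lambda>n. c n * character (- n) x) summable_on UNIV"
  by (rule abs_summable_summable) (simp add: norm_mult rapidly_decreasing_abs_summable)

lemma norm_fourier_sum_le:
  assumes "rapidly_decreasing c"
  shows "norm (fourier_sum c x) \<le> (\<Sum>\<^sub>\<infinity>n. norm (c n))"
  unfolding fourier_sum_def
  using norm_infsum_bound[of "\<lambda>n. c n * character (- n) x" UNIV] assms
  by (simp add: norm_mult rapidly_decreasing_abs_summable)

lemma fourier_sum_lincomb:
  assumes "rapidly_decreasing c" "rapidly_decreasing d"
  shows "fourier_sum (\<lambda>n. z * c n + d n) x = z * fourier_sum c x + fourier_sum d x"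
  unfolding fourier_sum_def
  using infsum_add[OF summable_on_cmult_right[OF fourier_sum_summable[OF assms(1)], of z]
      fourier_sum_summable[OF assms(2)], of x x]
  by (simp add: ring_distribs mult.assoc infsum_cmult_right')

lemma fourier_sum_sum:
  assumes "finite A" "\<And>j. j \<in> A \<Longrightarrow> rapidly_decreasing (c j)"
  shows "fourier_sum (\<lambda>n. \<Sum>j\<in>A. z j * c j n) x = (\<Sum>j\<in>A. z j * fourier_sum (c j) x) \<and>
    rapidly_decreasing (\<lambda>n. \<Sum>j\<in>A. z j * c j n)"
  using assms
proof (induction A)
  case empty
  then show ?case by (simp add: fourier_sum_def rapidly_decreasing_def)
next
  case (insert j A)
  then show ?case
    by (simp add: fourier_sum_lincomb rapidly_decreasing_lincomb)
qed

lemma has_derivative_of_quadratic_remainder: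
  fixes f :: "'a::real_normed_vector \<Rightarrow> 'b::real_normed_vector"
  assumes "bounded_linear D" "\<And>h. norm (f (x + h) - f x - D h) \<le> K * (norm h)\<^sup>2"
  shows "(f has_derivative D) (at x)"
  unfolding has_derivative_at
proof (intro conjI assms(1))
  show "(\<lambda>h. norm (f (x + h) - f x - D h) / norm h) \<midarrow>0\<rightarrow> 0"
  proof (rule tendsto_sandwich[where f = "\<lambda>_. 0"])
    show "\<forall>\<^sub>F h in at 0. norm (f (x + h) - f x - D h) / norm h \<le> K * norm h"
      using assms(2) by (intro always_eventually allI) (simp add: divide_le_eq power2_eq_square mult.assoc)
    show "((\<lambda>h. K * norm h) \<longlongrightarrow> 0) (at (0 :: 'a))"
      by (rule tendsto_eq_intros refl | simp)+
  qed auto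
qed

text \<open>The Taylor remainder of the \<open>n\<close>-th character is at most \<open>(norm (real_vec n) * norm h) ^ 2\<close>. The
  coefficients absorb the factor in \<open>n\<close>, so the remainders add up to a multiple of \<open>norm h ^ 2\<close>, which gives
  the total derivative directly.\<close>
lemma fourier_sum_has_derivative:
  fixes c :: "int ^ 'd::finite \<Rightarrow> complex"
  assumes c: "rapidly_decreasing c"
  shows "(fourier_sum c has_derivative
    (\<lambda>h. \<Sum>j\<in>UNIV. complex_of_real (h $ j) * fourier_sum (deriv_coeff j c) x)) (at x)"
proof (rule has_derivative_of_quadratic_remainder)
  show "bounded_linear (\<lambda>h. \<Sum>j\<in>UNIV. complex_of_real (h $ j) * fourier_sum (deriv_coeff j c) x)"
    by (intro bounded_linear_sum bounded_linear_mult_const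
        bounded_linear_of_real[THEN bounded_linear_compose] bounded_linear_vec_nth)
  fix h :: "real ^ 'd"
  let ?e = "\<lambda>n. (\<Sum>j\<in>UNIV. complex_of_real (h $ j) * deriv_coeff j c n)"
  have e: "fourier_sum ?e x = (\<Sum>j\<in>UNIV. complex_of_real (h $ j) * fourier_sum (deriv_coeff j c) x)"
      "rapidly_decreasing ?e"
    using fourier_sum_sum[of UNIV "\<lambda>j. deriv_coeff j c" "\<lambda>j. complex_of_real (h $ j)" x]
    by (simp_all add: rapidly_decreasing_deriv_coeff c)
  have e_eq: "?e n = c n * (\<i> * of_real (real_vec (- n) \<bullet> h))" for n
    by (simp add: deriv_coeff_def real_vec_uminus inner_vec_def sum_distrib_left sum_distrib_right
        sum_negf mult_ac)
  let ?t = "\<lambda>n. c n * character (- n) x * (character (- n) h - 1 - \<i> * of_real (real_vec (- n) \<bullet> h))"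
  have eq: "fourier_sum c (x + h) - fourier_sum c x - fourier_sum ?e x = infsum ?t UNIV"
  proof -
    have "((\<lambda>n. c n * character (- n) (x + h) + - (c n * character (- n) x) + - (?e n * character (- n) x))
        has_sum (fourier_sum c (x + h) + - fourier_sum c x + - fourier_sum ?e x)) UNIV"
      unfolding fourier_sum_def
      by (intro has_sum_add has_sum_uminusI has_sum_infsum fourier_sum_summable c e(2))
    moreover have "c n * character (- n) (x + h) + - (c n * character (- n) x) + - (?e n * character (- n) x) = ?t n" for n
      unfolding e_eq by (simp add: character_add algebra_simps)
    ultimately have "(?t has_sum (fourier_sum c (x + h) + - fourier_sum c x + - fourier_sum ?e x)) UNIV"
      by simp
    then show ?thesis by (simp add: infsumI)
  qed
  have tb: "norm (?t n) \<le> (norm h)\<^sup>2 * (bracket n ^ 2 * norm (c n))" for n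
  proof -
    have "norm (?t n) \<le> norm (c n) * (norm (real_vec (- n)) * norm h)\<^sup>2"
      unfolding norm_mult norm_character by (simp add: mult_left_mono character_quadratic_remainder)
    also have "\<dots> \<le> norm (c n) * (bracket n * norm h)\<^sup>2"
      by (intro mult_left_mono power_mono mult_right_mono) (simp_all add: norm_le_bracket real_vec_uminus)
    finally show ?thesis by (simp add: power_mult_distrib mult_ac)
  qed
  have sm: "(\<lambda>n. (norm h)\<^sup>2 * (bracket n ^ 2 * norm (c n))) summable_on UNIV"
    by (intro summable_on_cmult_right rapidly_decreasing_weighted c)
  have "?t summable_on UNIV"
    using Infinite_Sum.abs_summable_on_comparison_test'[OF sm tb] by (rule abs_summable_summable)
  then have "norm (fourier_sum c (x + h) - fourier_sum c x - fourier_sum ?e x)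
      \<le> (\<Sum>\<^sub>\<infinity>n. (norm h)\<^sup>2 * (bracket n ^ 2 * norm (c n)))"
    unfolding eq by (rule norm_infsum_le[OF has_sum_infsum has_sum_infsum[OF sm] tb])
  then show "norm (fourier_sum c (x + h) - fourier_sum c x
      - (\<Sum>j\<in>UNIV. complex_of_real (h $ j) * fourier_sum (deriv_coeff j c) x))
      \<le> (\<Sum>\<^sub>\<infinity>n. bracket n ^ 2 * norm (c n)) * (norm h)\<^sup>2"
    unfolding e(1) by (simp add: infsum_cmult_right' mult.commute)
qed

lemma partial_deriv_fourier_sum:
  assumes "rapidly_decreasing c"
  shows "partial_deriv j (fourier_sum c) = fourier_sum (deriv_coeff j c)"
proof
  fix x
  have "(\<Sum>i\<in>UNIV. complex_of_real (axis j 1 $ i) * fourier_sum (deriv_coeff i c) x)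
      = (\<Sum>i\<in>UNIV. if i = j then fourier_sum (deriv_coeff i c) x else 0)"
    by (rule sum.cong) (auto simp: axis_def)
  then show "partial_deriv j (fourier_sum c) x = fourier_sum (deriv_coeff j c) x"
    using partial_deriv_eqI[OF fourier_sum_has_derivative[OF assms, of x], of j] by simp
qed

lemma fourier_sum_test_function:
  assumes "rapidly_decreasing c"
  shows "fourier_sum c \<in> test_functions"
proof -
  have diff: "fourier_sum c differentiable (at x)" if "rapidly_decreasing c" for c :: "int ^ 'a \<Rightarrow> complex" and x
    using fourier_sum_has_derivative[OF that] differentiable_def by blast
  have "rapidly_decreasing c \<Longrightarrow> C_k k (fourier_sum c)" for k and c :: "int ^ 'a \<Rightarrow> complex"
  proof (induction k arbitrary: c)
    case 0
    then show ?case
      using diff by (auto simp: continuous_on_eq_continuous_at intro: differentiable_imp_continuous_within)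
  next
    case (Suc k)
    then show ?case by (simp add: diff partial_deriv_fourier_sum rapidly_decreasing_deriv_coeff)
  qed
  moreover have "periodic (fourier_sum c)"
    unfolding periodic_def fourier_sum_def
    by (intro allI infsum_cong) (metis character_periodic periodic_def)
  ultimately show ?thesis using assms by (simp add: test_functions_def smooth_def)
qed

lemma multi_deriv_fourier_sum:
  assumes "rapidly_decreasing c"
  shows "multi_deriv \<beta> (fourier_sum c) = fourier_sum (multi_power deriv_coeff \<beta> c)"
    and "rapidly_decreasing (multi_power deriv_coeff \<beta> c)"
  using multi_power_rel[where R = "\<lambda>f c. rapidly_decreasing c \<and> f = fourier_sum c" and D = partial_deriv
      and E = deriv_coeff and \<alpha> = \<beta> and g = "fourier_sum c" and h = c] assms
  by (auto simp: partial_deriv_fourier_sum rapidly_decreasing_deriv_coeff)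

text \<open>The exponent \<open>K\<close> depends on \<open>\<beta>\<close> alone; uniformity in \<open>c\<close> is what allows the estimate to be applied to
  the tails of a series.\<close>
lemma multi_power_deriv_coeff_le:
  fixes \<beta> :: "nat ^ 'd::finite"
  obtains K where "\<And>c n. norm (multi_power deriv_coeff \<beta> c n) \<le> bracket n ^ K * norm (c n)"
proof -
  have pow: "norm ((deriv_coeff j ^^ k) c n) \<le> bracket n ^ k * norm (c n)"
    for j k and c :: "int ^ 'd \<Rightarrow> complex" and n
  proof (induction k)
    case (Suc k)
    have "norm ((deriv_coeff j ^^ Suc k) c n) \<le> bracket n * norm ((deriv_coeff j ^^ k) c n)"
      by (simp add: norm_deriv_coeff_le)
    also have "\<dots> \<le> bracket n * (bracket n ^ k * norm (c n))"
      using Suc bracket_pos[of n] by (intro mult_left_mono) auto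
    finally show ?case by (simp add: mult.assoc)
  qed simp
  have "\<exists>K. \<forall>c n. norm (foldr (\<lambda>j. deriv_coeff j ^^ (\<beta> $ j)) js c n) \<le> bracket n ^ K * norm (c n)" for js
  proof (induction js)
    case Nil
    then show ?case by (intro exI[of _ 0]) simp
  next
    case (Cons j js)
    then obtain K where K: "\<And>c n. norm (foldr (\<lambda>j. deriv_coeff j ^^ (\<beta> $ j)) js c n) \<le> bracket n ^ K * norm (c n)"
      by blast
    have "norm (foldr (\<lambda>j. deriv_coeff j ^^ (\<beta> $ j)) (j # js) c n) \<le> bracket n ^ (\<beta> $ j + K) * norm (c n)" for c n
    proof -
      have "norm (foldr (\<lambda>j. deriv_coeff j ^^ (\<beta> $ j)) (j # js) c n)
          \<le> bracket n ^ (\<beta> $ j) * norm (foldr (\<lambda>j. deriv_coeff j ^^ (\<beta> $ j)) js c n)"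
        by (simp add: pow)
      also have "\<dots> \<le> bracket n ^ (\<beta> $ j) * (bracket n ^ K * norm (c n))"
        using bracket_pos[of n] by (intro mult_left_mono K) simp
      finally show ?thesis by (simp add: power_add mult.assoc)
    qed
    then show ?case by blast
  qed
  then show ?thesis using that unfolding multi_power_def by blast
qed

lemma test_seminorm_fourier_sum_le:
  fixes \<beta> :: "nat ^ 'd::finite"
  obtains K where "\<And>c. rapidly_decreasing c \<Longrightarrow>
    test_seminorm \<beta> (fourier_sum c) \<le> (\<Sum>\<^sub>\<infinity>n. bracket n ^ K * norm (c n))"
proof -
  obtain K where K: "\<And>c n. norm (multi_power deriv_coeff \<beta> c n) \<le> bracket n ^ K * norm (c n)"
    by (rule multi_power_deriv_coeff_le) (rule that)
  have "test_seminorm \<beta> (fourier_sum c) \<le> (\<Sum>\<^sub>\<infinity>n. bracket n ^ K * norm (c n))"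
    if c: "rapidly_decreasing c" for c
  proof (rule test_seminorm_leI)
    fix x
    have "norm (multi_deriv \<beta> (fourier_sum c) x) \<le> (\<Sum>\<^sub>\<infinity>n. norm (multi_power deriv_coeff \<beta> c n))"
      unfolding multi_deriv_fourier_sum(1)[OF c]
      by (rule norm_fourier_sum_le[OF multi_deriv_fourier_sum(2)[OF c]])
    also have "\<dots> \<le> (\<Sum>\<^sub>\<infinity>n. bracket n ^ K * norm (c n))"
      by (intro infsum_mono rapidly_decreasing_abs_summable multi_deriv_fourier_sum(2) c
          rapidly_decreasing_weighted K)
    finally show "norm (multi_deriv \<beta> (fourier_sum c) x) \<le> (\<Sum>\<^sub>\<infinity>n. bracket n ^ K * norm (c n))" .
  qed
  then show ?thesis by (rule that)
qed

text \<open>Characters are Fourier series with one term and thus inherit smoothness and derivatives from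
  the general case.\<close>
lemma character_eq_fourier_sum:
  "character n = fourier_sum (\<lambda>k. if k = - n then 1 else 0)"
  "rapidly_decreasing (\<lambda>k. if k = - n then 1 else 0)"
proof -
  have "fourier_sum (\<lambda>k. if k = - n then 1 else 0) x = infsum (\<lambda>k. character (- k) x) {- n}" for x
    unfolding fourier_sum_def by (rule infsum_cong_neutral) auto
  then show "character n = fourier_sum (\<lambda>k. if k = - n then 1 else 0)" by auto
  have "(\<lambda>k. bracket k ^ l * norm (if k = - n then 1 else 0 :: complex)) summable_on UNIV
      \<longleftrightarrow> (\<lambda>k. bracket k ^ l) summable_on {- n}" for l
    by (rule summable_on_cong_neutral) auto
  then show "rapidly_decreasing (\<lambda>k. if k = - n then 1 else 0)"
    by (simp add: rapidly_decreasing_def)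
qed

lemma character_test_function: "character n \<in> test_functions"
  using fourier_sum_test_function[OF character_eq_fourier_sum(2)] character_eq_fourier_sum(1) by metis

text \<open>A distribution has finite order, and the tails of a rapidly convergent Fourier series tend to
  zero in every seminorm.\<close>
lemma distribution_fourier_sum:
  fixes c :: "int ^ 'd::finite \<Rightarrow> complex"
  assumes u: "u \<in> distributions" and c: "rapidly_decreasing c"
  shows "((\<lambda>n. c n * u (character (- n))) has_sum u (fourier_sum c)) UNIV"
proof -
  obtain B C where B: "finite B" "0 \<le> C"
      "\<And>\<phi>. \<phi> \<in> test_functions \<Longrightarrow> norm (u \<phi>) \<le> C * (\<Sum>\<beta>\<in>B. test_seminorm \<beta> \<phi>)"
    by (rule distribution_bound[OF u]) (rule that)
  have "\<forall>\<beta>::nat ^ 'd. \<exists>K. \<forall>c. rapidly_decreasing c \<longrightarrow>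
      test_seminorm \<beta> (fourier_sum c) \<le> (\<Sum>\<^sub>\<infinity>n. bracket n ^ K * norm (c n))"
    by (rule allI, rule test_seminorm_fourier_sum_le) (intro exI allI impI)
  from choice[OF this] obtain K where K: "\<forall>\<beta>::nat ^ 'd. \<forall>c. rapidly_decreasing c \<longrightarrow>
      test_seminorm \<beta> (fourier_sum c) \<le> (\<Sum>\<^sub>\<infinity>n. bracket n ^ K \<beta> * norm (c n))"
    by (elim exE) (rule that)
  define w where "w = (\<lambda>\<beta> n. bracket n ^ K \<beta> * norm (c n))"
  have w: "w \<beta> summable_on UNIV" for \<beta>
    unfolding w_def by (rule rapidly_decreasing_weighted[OF c])
  define tail where "tail F n = (if n \<in> F then 0 else c n)" for F n
  have tail: "rapidly_decreasing (tail F)" for F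
    by (rule rapidly_decreasing_le[OF c, where C = 1 and l = 0]) (simp add: tail_def)
  have split: "u (fourier_sum c) = (\<Sum>n\<in>F. c n * u (character (- n))) + u (fourier_sum (tail F))"
    if "finite F" for F
    using that
  proof (induction F)
    case empty
    then show ?case by (simp add: tail_def)
  next
    case (insert n F)
    have "fourier_sum (tail F) x = c n * character (- n) x + fourier_sum (tail (insert n F)) x" for x
    proof -
      have "tail F = (\<lambda>k. c n * (if k = - (- n) then 1 else 0) + tail (insert n F) k)"
        using insert.hyps by (auto simp: tail_def)
      then have "fourier_sum (tail F) x
          = c n * fourier_sum (\<lambda>k. if k = - (- n) then 1 else 0) x + fourier_sum (tail (insert n F)) x"
        by (simp only:) (rule fourier_sum_lincomb[OF character_eq_fourier_sum(2) tail])
      then show ?thesis unfolding character_eq_fourier_sum(1)[symmetric] .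
    qed
    then have "fourier_sum (tail F) = (\<lambda>x. c n * character (- n) x + fourier_sum (tail (insert n F)) x)"
      by (rule ext)
    then have "u (fourier_sum (tail F)) = u (\<lambda>x. c n * character (- n) x + fourier_sum (tail (insert n F)) x)"
      by (rule arg_cong)
    also have "\<dots> = c n * u (character (- n)) + u (fourier_sum (tail (insert n F)))"
      using distribution_add[OF u test_functions_cmult[OF character_test_function] fourier_sum_test_function[OF tail]]
        distribution_cmult[OF u character_test_function] by simp
    finally show ?case using insert by (simp add: add.assoc add.commute add.left_commute)
  qed
  have infsum_tail: "(\<Sum>\<^sub>\<infinity>n. bracket n ^ K \<beta> * norm (tail F n)) = infsum (w \<beta>) UNIV - sum (w \<beta>) F"
    if "finite F" for F \<beta>
  proof -
    have "(\<Sum>\<^sub>\<infinity>n. bracket n ^ K \<beta> * norm (tail F n)) = infsum (w \<beta>) (UNIV - F)"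
      by (rule infsum_cong_neutral) (auto simp: tail_def w_def)
    also have "\<dots> = infsum (w \<beta>) UNIV - infsum (w \<beta>) F"
      using w that by (intro infsum_Diff) (auto intro: summable_on_finite)
    finally show ?thesis using that by simp
  qed
  have "((\<lambda>F. C * (\<Sum>\<beta>\<in>B. infsum (w \<beta>) UNIV - sum (w \<beta>) F)) \<longlongrightarrow>
      C * (\<Sum>\<beta>\<in>B. infsum (w \<beta>) UNIV - infsum (w \<beta>) UNIV)) (finite_subsets_at_top UNIV)"
    by (intro tendsto_intros infsum_tendsto w)
  then have lim: "((\<lambda>F. C * (\<Sum>\<beta>\<in>B. infsum (w \<beta>) UNIV - sum (w \<beta>) F)) \<longlongrightarrow> 0) (finite_subsets_at_top UNIV)"
    by simp
  have "norm ((\<Sum>n\<in>F. c n * u (character (- n))) - u (fourier_sum c))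
      \<le> C * (\<Sum>\<beta>\<in>B. infsum (w \<beta>) UNIV - sum (w \<beta>) F)" if "finite F" for F
  proof -
    have "norm (u (fourier_sum (tail F))) \<le> C * (\<Sum>\<beta>\<in>B. test_seminorm \<beta> (fourier_sum (tail F)))"
      by (rule B(3)[OF fourier_sum_test_function[OF tail]])
    also have "\<dots> \<le> C * (\<Sum>\<beta>\<in>B. infsum (w \<beta>) UNIV - sum (w \<beta>) F)"
      using K[rule_format, OF tail[of F]] B(2) by (intro mult_left_mono sum_mono) (auto simp: infsum_tail[OF that])
    finally show ?thesis unfolding split[OF that] by simp
  qed
  then have "((\<lambda>F. (\<Sum>n\<in>F. c n * u (character (- n))) - u (fourier_sum c)) \<longlongrightarrow> 0) (finite_subsets_at_top UNIV)"
    by (intro Lim_null_comparison[OF _ lim]) (auto simp: eventually_finite_subsets_at_top)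
  then show ?thesis unfolding has_sum_def by (rule LIM_zero_cancel)
qed

lemma partial_deriv_character: "partial_deriv j (character n) = (\<lambda>x. \<i> * of_int (n $ j) * character n x)"
proof -
  let ?d = "\<lambda>k. if k = - n then 1 else 0 :: complex"
  have "deriv_coeff j ?d = (\<lambda>k. \<i> * of_int (n $ j) * ?d k + 0)"
    by (auto simp: deriv_coeff_def)
  moreover have "rapidly_decreasing (\<lambda>k::int^'a. 0 :: complex)" by (simp add: rapidly_decreasing_def)
  moreover have "fourier_sum (\<lambda>k. 0) x = 0" for x :: "real^'a" by (simp add: fourier_sum_def)
  ultimately have "fourier_sum (deriv_coeff j ?d) = (\<lambda>x. \<i> * of_int (n $ j) * character n x)"
    using fourier_sum_lincomb[OF character_eq_fourier_sum(2)[of n], of "\<lambda>k. 0" "\<i> * of_int (n $ j)"]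
    by (auto simp flip: character_eq_fourier_sum(1))
  then show ?thesis
    using partial_deriv_fourier_sum[OF character_eq_fourier_sum(2)[of n], of j]
    by (simp flip: character_eq_fourier_sum(1))
qed

lemma continuous_character: "continuous_on UNIV (character n)"
  by (rule smooth_continuous[OF test_functionsD(1)[OF character_test_function]])

section \<open>Integration over the torus\<close>

abbreviation torus_cube :: "(real ^ 'd::finite) set" where
  "torus_cube \<equiv> cbox 0 (\<chi> j. 2 * pi)"

lemma torus_integrable: "continuous_on UNIV f \<Longrightarrow> (f :: real ^ 'd::finite \<Rightarrow> complex) integrable_on cbox a b"
  by (rule integrable_continuous) (auto intro: continuous_on_subset)

lemma torus_integral_eq_integral:
  assumes "continuous_on UNIV f"
  shows "torus_integral f = integral torus_cube f"
proof -
  have "set_integrable lborel torus_cube f"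
    unfolding set_integrable_def
    by (intro borel_integrable_compact compact_cbox continuous_on_subset[OF assms]) simp
  then show ?thesis
    unfolding torus_integral_def by (rule set_borel_integral_eq_integral)
qed

lemma torus_integral_lincomb:
  assumes "continuous_on UNIV f" "continuous_on UNIV g"
  shows "torus_integral (\<lambda>x. c * f x + g x) = c * torus_integral f + torus_integral g"
proof -
  have "continuous_on UNIV (\<lambda>x. c * f x)" using assms(1) by (intro continuous_intros)
  moreover have "continuous_on UNIV (\<lambda>x. c * f x + g x)" using assms by (intro continuous_intros)
  ultimately show ?thesis
    using assms by (simp add: torus_integral_eq_integral integral_add torus_integrable)
qed

lemma measure_torus_cube: "measure lborel (torus_cube :: (real ^ 'd::finite) set) = (2 * pi) ^ CARD('d)"
proof -
  have "torus_cube \<noteq> ({} :: (real ^ 'd) set)" by (simp add: interval_ne_empty_cart)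
  then show ?thesis by (simp add: content_cbox_cart)
qed

lemma norm_torus_integral_le:
  fixes f :: "real ^ 'd::finite \<Rightarrow> complex"
  assumes "continuous_on UNIV f" "\<And>x. norm (f x) \<le> B"
  shows "norm (torus_integral f) \<le> (2 * pi) ^ CARD('d) * B"
proof -
  have "0 \<le> B" using assms(2) norm_ge_zero order_trans by blast
  then have "norm (integral torus_cube f) \<le> B * measure lborel (torus_cube :: (real ^ 'd) set)"
    by (rule has_integral_bound[OF _ integrable_integral[OF torus_integrable[OF assms(1)]]]) (rule assms(2))
  then show ?thesis
    unfolding torus_integral_eq_integral[OF assms(1)] measure_torus_cube by (simp add: mult.commute)
qed

lemma mem_cbox_axis:
  fixes x :: "real ^ 'd::finite"
  shows "x \<in> cbox (axis j s) ((\<chi> j. 2 * pi) + axis j r) \<longleftrightarrow>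
    s \<le> x $ j \<and> x $ j \<le> 2 * pi + r \<and> (\<forall>i. i \<noteq> j \<longrightarrow> 0 \<le> x $ i \<and> x $ i \<le> 2 * pi)"
  unfolding mem_box_cart by (auto simp: axis_def)

text \<open>The part of the translated cube that sticks out is moved back by a period.\<close>
lemma integral_periodic_shift:
  fixes f :: "real ^ 'd::finite \<Rightarrow> complex"
  assumes cont: "continuous_on UNIV f" and per: "periodic f" and t: "0 \<le> t" "t \<le> 2 * pi"
  shows "integral torus_cube (\<lambda>x. f (x + axis j t)) = integral torus_cube f"
proof -
  let ?b = "(\<chi> j. 2 * pi) :: real ^ 'd"
  let ?box = "\<lambda>s r. cbox (axis j s) (?b + axis j r) :: (real ^ 'd) set"
  have cube: "torus_cube = ?box 0 0" by (simp add: axis_def vec_eq_iff flip: zero_vec_def)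
  have add_axis: "axis j s + axis j r = (axis j (s + r) :: real ^ 'd)" for s r
    by (simp add: axis_def vec_eq_iff)
  have shift: "integral (?box s r) (\<lambda>x. f (x + axis j q)) = integral (?box (s + q) (r + q)) f" for s r q
    using integral_shift_cbox[of "axis j (s + q)" "axis j q" "?b + axis j (r + q)" f]
    by (simp add: add_axis[symmetric])
  have split: "integral (?box s r) f = integral (?box s r \<inter> {x. x \<bullet> axis j 1 \<le> q}) f
      + integral (?box s r \<inter> {x. x \<bullet> axis j 1 \<ge> q}) f" for s r q
    by (rule integral_split[OF torus_integrable[OF cont]]) (simp add: axis_in_Basis_iff)
  have inner: "x \<bullet> axis j 1 = x $ j" for x :: "real ^ 'd" by (simp add: inner_axis)
  have "integral torus_cube (\<lambda>x. f (x + axis j t)) = integral (?box t t) f"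
    unfolding cube using shift[of 0 0 t] by simp
  also have "\<dots> = integral (?box t 0) f + integral (?box (2 * pi) t) f"
  proof -
    have "?box t t \<inter> {x. x \<bullet> axis j 1 \<le> 2 * pi} = ?box t 0"
      "?box t t \<inter> {x. x \<bullet> axis j 1 \<ge> 2 * pi} = ?box (2 * pi) t"
      unfolding set_eq_iff Int_iff mem_Collect_eq mem_cbox_axis inner using t by auto
    then show ?thesis using split[of t t "2 * pi"] by simp
  qed
  also have "integral (?box (2 * pi) t) f = integral (?box 0 (t - 2 * pi)) f"
    using shift[of 0 "t - 2 * pi" "2 * pi"] per by (simp add: periodic_def)
  also have "integral (?box t 0) f + integral (?box 0 (t - 2 * pi)) f = integral (?box 0 0) f"
  proof -
    have "?box 0 0 \<inter> {x. x \<bullet> axis j 1 \<le> t} = ?box 0 (t - 2 * pi)"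
      "?box 0 0 \<inter> {x. x \<bullet> axis j 1 \<ge> t} = ?box t 0"
      unfolding set_eq_iff Int_iff mem_Collect_eq mem_cbox_axis inner using t by auto
    then show ?thesis using split[of 0 0 t] by simp
  qed
  finally show ?thesis unfolding cube .
qed

text \<open>By translation invariance the integral of the translates of \<open>G\<close> along the axis is constant;
  differentiating it under the integral sign gives the integral of the partial derivative.\<close>
lemma torus_integral_partial_deriv:
  fixes G G' :: "real ^ 'd::finite \<Rightarrow> complex"
  assumes G: "continuous_on UNIV G" "periodic G" and G': "continuous_on UNIV G'"
    and deriv: "\<And>x. ((\<lambda>t. G (x + t *\<^sub>R axis j 1)) has_vector_derivative G' x) (at 0)"
  shows "torus_integral G' = 0"
proof -
  have deriv_at: "((\<lambda>s. G (x + s *\<^sub>R axis j 1)) has_vector_derivative G' (x + t *\<^sub>R axis j 1))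
      (at t within {0..1})" for x t
  proof -
    have "((\<lambda>s. s - t) has_vector_derivative 1) (at t)"
      by (auto intro!: derivative_eq_intros)
    then have "((\<lambda>s. G ((x + t *\<^sub>R axis j 1) + s *\<^sub>R axis j 1)) \<circ> (\<lambda>s. s - t)
        has_vector_derivative 1 *\<^sub>R G' (x + t *\<^sub>R axis j 1)) (at t)"
      using deriv[of "x + t *\<^sub>R axis j 1"] by (intro vector_diff_chain_at) auto
    then show ?thesis
      by (simp add: o_def scaleR_left_diff_distrib algebra_simps has_vector_derivative_at_within)
  qed
  have "((\<lambda>s. integral torus_cube (\<lambda>x. G (x + s *\<^sub>R axis j 1))) has_vector_derivative
      integral torus_cube (\<lambda>x. G' (x + 0 *\<^sub>R axis j 1))) (at 0 within {0..1})"
  proof (rule leibniz_rule_vector_derivative)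
    show "(\<lambda>x. G (x + s *\<^sub>R axis j 1)) integrable_on torus_cube" for s
      by (intro torus_integrable continuous_on_compose2[OF G(1)] continuous_intros) auto
    show "continuous_on ({0..1} \<times> torus_cube) (\<lambda>(s, x). G' (x + s *\<^sub>R axis j 1))"
      unfolding case_prod_beta by (intro continuous_on_compose2[OF G'] continuous_intros) auto
  qed (auto intro: deriv_at)
  moreover have "((\<lambda>s. integral torus_cube (\<lambda>x. G (x + s *\<^sub>R axis j 1))) has_vector_derivative 0)
      (at 0 within {0..1})"
  proof (rule has_vector_derivative_transform[where f = "\<lambda>s. integral torus_cube G"])
    fix s :: real assume "s \<in> {0..1}"
    moreover have "s *\<^sub>R axis j 1 = (axis j s :: real ^ 'd)" by (simp add: axis_def vec_eq_iff)
    ultimately show "integral torus_cube (\<lambda>x. G (x + s *\<^sub>R axis j 1)) = integral torus_cube G"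
      using integral_periodic_shift[OF G, of s j] pi_gt3 by simp
  qed auto
  ultimately have "integral torus_cube G' = 0"
    using vector_derivative_unique_within_closed_interval[of 0 1 0] by fastforce
  then show ?thesis by (simp add: torus_integral_eq_integral G')
qed

text \<open>For \<open>n \<noteq> 0\<close> the character is a multiple of one of its own partial derivatives.\<close>
lemma torus_integral_character:
  fixes n :: "int ^ 'd::finite"
  shows "torus_integral (character n) = (if n = 0 then (2 * of_real pi) ^ CARD('d) else 0)"
proof (cases "n = 0")
  case True
  then have "character n = (\<lambda>x. 1)" by auto
  then have "torus_integral (character n) = integral (torus_cube :: (real ^ 'd) set) (\<lambda>x. 1)"
    using torus_integral_eq_integral[OF continuous_character[of n]] by simp
  also have "\<dots> = of_real (measure lborel (torus_cube :: (real ^ 'd) set))"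
    by (simp add: scaleR_conv_of_real)
  finally show ?thesis using True by (simp only: measure_torus_cube) simp
next
  case False
  then obtain j where j: "n $ j \<noteq> 0" by (auto simp: vec_eq_iff)
  let ?G' = "\<lambda>x. \<i> * of_int (n $ j) * character n x"
  have cont: "continuous_on UNIV ?G'" by (intro continuous_intros continuous_character)
  have "torus_integral ?G' = 0"
    using smooth_has_partial_deriv[OF test_functionsD(1)[OF character_test_function], of n _ j]
    by (intro torus_integral_partial_deriv[OF continuous_character character_periodic cont])
      (simp add: partial_deriv_character)
  moreover have "torus_integral ?G' = \<i> * of_int (n $ j) * torus_integral (character n)"
    using torus_integral_lincomb[OF continuous_character, of "\<lambda>x. 0" "\<i> * of_int (n $ j)" n]
    by (simp add: torus_integral_def)
  ultimately show ?thesis using j False by simp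
qed

lemma integration_by_parts:
  assumes b: "b \<in> test_functions" and \<phi>: "\<phi> \<in> test_functions"
  shows "\<i> * of_int (n $ j) * torus_integral (\<lambda>x. b x * character n x * \<phi> x)
    = - (torus_integral (\<lambda>x. partial_deriv j b x * character n x * \<phi> x)
       + torus_integral (\<lambda>x. b x * character n x * partial_deriv j \<phi> x))"
proof -
  note cont = test_functionsD(1)[OF b, THEN smooth_continuous]
    test_functionsD(1)[OF \<phi>, THEN smooth_continuous]
    test_functionsD(1)[OF b, THEN smooth_partial_deriv, THEN smooth_continuous]
    test_functionsD(1)[OF \<phi>, THEN smooth_partial_deriv, THEN smooth_continuous]
    continuous_character
  let ?A = "\<lambda>x. b x * character n x * \<phi> x"
  let ?B = "\<lambda>x. partial_deriv j b x * character n x * \<phi> x"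
  let ?C = "\<lambda>x. b x * character n x * partial_deriv j \<phi> x"
  let ?G' = "\<lambda>x. \<i> * of_int (n $ j) * ?A x + (1 * ?B x + ?C x)"
  have G': "continuous_on UNIV ?G'" by (intro continuous_intros cont)
  have deriv: "((\<lambda>t. ?A (x + t *\<^sub>R axis j 1)) has_vector_derivative ?G' x) (at 0)" for x
    using has_vector_derivative_mult[OF has_vector_derivative_mult[OF
          smooth_has_partial_deriv[OF test_functionsD(1)[OF b], of x j]
          smooth_has_partial_deriv[OF test_functionsD(1)[OF character_test_function], of n x j]]
          smooth_has_partial_deriv[OF test_functionsD(1)[OF \<phi>], of x j]]
    by (simp add: partial_deriv_character algebra_simps)
  have "periodic ?A"
    using test_functionsD(2)[OF b] test_functionsD(2)[OF \<phi>] character_periodic[of n] by (simp add: periodic_def)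
  then have "torus_integral ?G' = 0"
    by (intro torus_integral_partial_deriv[OF _ _ G' deriv]) (intro continuous_intros cont)
  moreover have "torus_integral ?G' = \<i> * of_int (n $ j) * torus_integral ?A + (1 * torus_integral ?B + torus_integral ?C)"
    by (subst torus_integral_lincomb, (intro continuous_intros cont)+)+ simp
  ultimately show ?thesis by (simp add: add_eq_0_iff)
qed

text \<open>Each integration by parts distributes one derivative over the two factors, whence the power
  of two.\<close>
lemma oscillatory_integral_decay:
  fixes n :: "int ^ 'd::finite"
  assumes "b \<in> test_functions" "\<phi> \<in> test_functions"
    and "\<And>l x. l \<le> k \<Longrightarrow> norm ((partial_deriv j ^^ l) b x) \<le> M"
    and "\<And>l x. l \<le> k \<Longrightarrow> norm ((partial_deriv j ^^ l) \<phi> x) \<le> N"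
  shows "\<bar>real_of_int (n $ j)\<bar> ^ k * norm (torus_integral (\<lambda>x. b x * character n x * \<phi> x))
    \<le> (2 * pi) ^ CARD('d) * 2 ^ k * (M * N)"
  using assms
proof (induction k arbitrary: b \<phi>)
  case 0
  have "0 \<le> M" using 0(3)[of 0] norm_ge_zero order_trans by blast
  then have "norm (b x * character n x * \<phi> x) \<le> M * N" for x
    using 0(3)[of 0 x] 0(4)[of 0 x] by (simp add: norm_mult mult_mono)
  moreover have "continuous_on UNIV (\<lambda>x. b x * character n x * \<phi> x)"
    by (intro continuous_intros continuous_character smooth_continuous test_functionsD(1) 0)
  ultimately show ?case using norm_torus_integral_le by fastforce
next
  case (Suc k)
  let ?I = "\<lambda>b \<phi>. torus_integral (\<lambda>x. b x * character n x * \<phi> x)"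
  have test: "partial_deriv j \<psi> \<in> test_functions" if "\<psi> \<in> test_functions" for \<psi>
    using that by (simp add: test_functions_def smooth_partial_deriv periodic_partial_deriv)
  have "norm (\<i> * of_int (n $ j) * ?I b \<phi>) \<le> norm (?I (partial_deriv j b) \<phi>) + norm (?I b (partial_deriv j \<phi>))"
    unfolding integration_by_parts[OF Suc.prems(1,2)] norm_minus_cancel by (rule norm_triangle_ineq)
  then have "\<bar>real_of_int (n $ j)\<bar> * norm (?I b \<phi>) \<le> norm (?I (partial_deriv j b) \<phi>) + norm (?I b (partial_deriv j \<phi>))"
    by (simp add: norm_mult)
  then have "\<bar>real_of_int (n $ j)\<bar> ^ k * (\<bar>real_of_int (n $ j)\<bar> * norm (?I b \<phi>))
      \<le> \<bar>real_of_int (n $ j)\<bar> ^ k * (norm (?I (partial_deriv j b) \<phi>) + norm (?I b (partial_deriv j \<phi>)))"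
    by (rule mult_left_mono) simp
  then have "\<bar>real_of_int (n $ j)\<bar> ^ Suc k * norm (?I b \<phi>)
      \<le> \<bar>real_of_int (n $ j)\<bar> ^ k * (norm (?I (partial_deriv j b) \<phi>) + norm (?I b (partial_deriv j \<phi>)))"
    by (simp only: power_Suc2 mult.assoc)
  also have "\<dots> \<le> (2 * pi) ^ CARD('d) * 2 ^ k * (M * N) + (2 * pi) ^ CARD('d) * 2 ^ k * (M * N)"
    unfolding distrib_left
  proof (intro add_mono Suc.IH)
    show "norm ((partial_deriv j ^^ l) (partial_deriv j b) x) \<le> M" if "l \<le> k" for l x
      using Suc.prems(3)[of "Suc l" x] that by (simp add: funpow_swap1)
    show "norm ((partial_deriv j ^^ l) (partial_deriv j \<phi>) x) \<le> N" if "l \<le> k" for l x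
      using Suc.prems(4)[of "Suc l" x] that by (simp add: funpow_swap1)
    show "norm ((partial_deriv j ^^ l) b x) \<le> M" if "l \<le> k" for l x
      using Suc.prems(3)[of l x] that by simp
    show "norm ((partial_deriv j ^^ l) \<phi> x) \<le> N" if "l \<le> k" for l x
      using Suc.prems(4)[of l x] that by simp
  qed (use Suc.prems test in auto)
  finally show ?case by (simp add: power_mult_distrib mult_ac)
qed

section \<open>Summability over the lattice\<close>

lemma inverse_square_summable_int: "(\<lambda>k::int. 1 / (1 + (real_of_int k)\<^sup>2)) summable_on UNIV"
proof -
  let ?h = "\<lambda>k::int. 1 / (1 + (real_of_int k)\<^sup>2)"
  \<comment> \<open>The integers are split into \<open>0, 1, 2, \<dots>\<close> and \<open>-1, -2, \<dots>\<close>.\<close>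
  have s: "summable (\<lambda>k. 1 / (1 + (real k)\<^sup>2))"
  proof (rule summable_comparison_test')
    show "summable (\<lambda>k. inverse (real k ^ 2))" by (rule inverse_power_summable) simp
    show "norm (1 / (1 + (real k)\<^sup>2)) \<le> inverse (real k ^ 2)" if "1 \<le> k" for k
      using that by (simp add: inverse_eq_divide frac_le)
  qed
  have nat: "(\<lambda>k. 1 / (1 + (real k)\<^sup>2)) summable_on UNIV"
    by (rule summable_nonneg_imp_summable_on[OF s]) simp
  have "(\<lambda>k. 1 / (1 + (real (Suc k))\<^sup>2)) summable_on UNIV"
    using s by (intro summable_nonneg_imp_summable_on) (auto simp: summable_Suc_iff[of "\<lambda>k. 1 / (1 + (real k)\<^sup>2)"] simp del: of_nat_Suc)
  then have "?h summable_on range (\<lambda>k. - int (Suc k))"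
    by (subst summable_on_reindex) (auto simp: inj_on_def o_def power2_eq_square algebra_simps)
  moreover have "?h summable_on range int"
    using nat by (subst summable_on_reindex) (auto simp: o_def)
  ultimately have "?h summable_on (range int \<union> range (\<lambda>k. - int (Suc k)))"
    by (intro summable_on_Un_disjoint) auto
  moreover have "range int \<union> range (\<lambda>k. - int (Suc k)) = UNIV"
  proof (intro set_eqI iffI UNIV_I)
    fix k :: int
    show "k \<in> range int \<union> range (\<lambda>k. - int (Suc k))" by (cases k rule: int_cases) auto
  qed
  ultimately show ?thesis by simp
qed

text \<open>Each factor \<open>bracket n ^ 2\<close> dominates \<open>1 + (n $ j) ^ 2\<close> for one coordinate \<open>j\<close>; the resulting product
  majorant is summed coordinate by coordinate.\<close>
lemma bracket_power_summable: "(\<lambda>n::int ^ 'd::finite. 1 / bracket n ^ (2 * CARD('d))) summable_on UNIV"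
proof (rule nonneg_bdd_above_summable_on)
  let ?h = "\<lambda>k::int. 1 / (1 + (real_of_int k)\<^sup>2)"
  have pos: "0 < 1 + (real_of_int k)\<^sup>2" for k by (simp add: add_pos_nonneg)
  have le: "1 / bracket n ^ (2 * CARD('d)) \<le> (\<Prod>j\<in>UNIV. ?h (n $ j))" for n :: "int ^ 'd"
  proof -
    have "(\<Prod>j\<in>UNIV. 1 + (real_of_int (n $ j))\<^sup>2) \<le> (\<Prod>j\<in>(UNIV :: 'd set). (bracket n)\<^sup>2)"
    proof (intro prod_mono conjI)
      fix j
      have "\<bar>real_of_int (n $ j)\<bar>\<^sup>2 \<le> (norm (real_vec n))\<^sup>2"
        using component_le_norm_cart[of "real_vec n" j] by (intro power_mono) auto
      then show "1 + (real_of_int (n $ j))\<^sup>2 \<le> (bracket n)\<^sup>2" by (simp add: bracket_def)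
    qed (use pos less_imp_le in auto)
    also have "\<dots> = bracket n ^ (2 * CARD('d))" by (simp add: power_mult)
    finally have "1 / bracket n ^ (2 * CARD('d)) \<le> 1 / (\<Prod>j\<in>UNIV. 1 + (real_of_int (n $ j))\<^sup>2)"
      using pos by (intro divide_left_mono mult_pos_pos prod_pos) (auto simp: bracket_pos)
    then show ?thesis by (simp add: prod_dividef)
  qed
  have "sum (\<lambda>n::int ^ 'd. 1 / bracket n ^ (2 * CARD('d))) F \<le> infsum ?h UNIV ^ CARD('d)" if "finite F" for F
  proof -
    define A where "A = (\<Union>n\<in>F. range (\<lambda>j. n $ j))"
    have "finite A" using that by (simp add: A_def)
    have "sum (\<lambda>n::int ^ 'd. 1 / bracket n ^ (2 * CARD('d))) F \<le> (\<Sum>n\<in>F. \<Prod>j\<in>UNIV. ?h (n $ j))"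
      by (intro sum_mono le)
    also have "\<dots> = (\<Sum>g\<in>vec_nth ` F. \<Prod>j\<in>UNIV. ?h (g j))"
      by (subst sum.reindex) (auto simp: inj_on_def vec_nth_inject)
    also have "\<dots> \<le> (\<Sum>g\<in>PiE (UNIV :: 'd set) (\<lambda>_. A). \<Prod>j\<in>UNIV. ?h (g j))"
    proof (rule sum_mono2)
      show "finite (PiE (UNIV :: 'd set) (\<lambda>_. A))" using \<open>finite A\<close> by (intro finite_PiE) auto
    qed (auto simp: A_def intro!: prod_nonneg)
    also have "\<dots> = (\<Prod>j\<in>(UNIV :: 'd set). \<Sum>k\<in>A. ?h k)"
      using \<open>finite A\<close> by (subst prod_sum_PiE) auto
    also have "\<dots> \<le> (\<Prod>j\<in>(UNIV :: 'd set). infsum ?h UNIV)"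
      using \<open>finite A\<close> by (intro prod_mono conjI sum_nonneg finite_sum_le_infsum inverse_square_summable_int) auto
    finally show ?thesis by simp
  qed
  then show "bdd_above (sum (\<lambda>n::int ^ 'd. 1 / bracket n ^ (2 * CARD('d))) ` {F. F \<subseteq> UNIV \<and> finite F})"
    by (auto simp: bdd_above_def)
qed (use bracket_pos less_imp_le in auto)

section \<open>The transposed operator\<close>

text \<open>The coefficients of the transposed operator: the quantization applied to \<open>f\<close> and paired with \<open>\<phi>\<close> is
  \<open>\<Sum> transpose_coeff a \<phi> n * f (character (- n))\<close>.\<close>
definition transpose_coeff ::
  "(real ^ 'd::finite \<Rightarrow> int ^ 'd \<Rightarrow> complex) \<Rightarrow> (real ^ 'd \<Rightarrow> complex) \<Rightarrow> int ^ 'd \<Rightarrow> complex" where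
  "transpose_coeff a \<phi> n =
     torus_integral (\<lambda>x. a x n * character n x * \<phi> x) / (2 * of_real pi) ^ CARD('d)"

definition transposed ::
  "(real ^ 'd::finite \<Rightarrow> int ^ 'd \<Rightarrow> complex) \<Rightarrow> (real ^ 'd \<Rightarrow> complex) \<Rightarrow> real ^ 'd \<Rightarrow> complex" where
  "transposed a \<phi> = fourier_sum (transpose_coeff a \<phi>)"

lemma symbol_test_function:
  assumes "a \<in> symbol_class m"
  shows "(\<lambda>x. a x n) \<in> test_functions"
  using assms by (simp add: symbol_class_def test_functions_def)

text \<open>The order \<open>m\<close> is rounded up to a natural exponent, so that it can be absorbed by performing that
  many additional integrations by parts.\<close>
lemma symbol_deriv_bound:
  fixes a :: "real ^ 'd::finite \<Rightarrow> int ^ 'd \<Rightarrow> complex"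
  assumes "a \<in> symbol_class m"
  shows "\<exists>A\<ge>0. \<forall>x n. norm (multi_deriv \<beta> (\<lambda>y. a y n) x) \<le> A * bracket n ^ nat \<lceil>m\<rceil>"
proof -
  have "bdd_above (range (\<lambda>(x, n). bracket n powr (- m + real (\<Sum>j\<in>UNIV. \<alpha> $ j)) *
      norm (multi_difference \<alpha> (\<lambda>k. multi_deriv \<beta> (\<lambda>y. a y k) x) n)))" for \<alpha>
    using assms by (simp add: symbol_class_def)
  from this[of 0] obtain A where A: "\<And>x n. bracket n powr (- m) * norm (multi_deriv \<beta> (\<lambda>y. a y n) x) \<le> A"
    by (auto simp: bdd_above_def multi_power_zero)
  have "0 \<le> A" by (rule order_trans[OF _ A[of 0 0]]) simp
  have "norm (multi_deriv \<beta> (\<lambda>y. a y n) x) \<le> A * bracket n ^ nat \<lceil>m\<rceil>" for x n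
  proof -
    have "norm (multi_deriv \<beta> (\<lambda>y. a y n) x) = bracket n powr m * (bracket n powr (- m) * norm (multi_deriv \<beta> (\<lambda>y. a y n) x))"
      using bracket_pos[of n] by (simp add: powr_minus field_simps)
    also have "\<dots> \<le> bracket n powr m * A"
      by (intro mult_left_mono A) simp
    also have "\<dots> \<le> bracket n powr real (nat \<lceil>m\<rceil>) * A"
      using bracket_ge_1[of n] \<open>0 \<le> A\<close> by (intro mult_right_mono powr_mono) (auto simp: of_nat_ceiling)
    also have "\<dots> = A * bracket n ^ nat \<lceil>m\<rceil>"
      using bracket_pos[of n] by (simp add: powr_realpow)
    finally show ?thesis .
  qed
  with \<open>0 \<le> A\<close> show ?thesis by blast
qed

lemma bracket_le_max_component:
  fixes n :: "int ^ 'd::finite"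
  shows "\<exists>j. bracket n \<le> (real CARD('d) + 1) * max 1 \<bar>real_of_int (n $ j)\<bar>"
proof -
  let ?M = "Max (range (\<lambda>j. \<bar>real_of_int (n $ j)\<bar>))"
  have "?M \<in> range (\<lambda>j. \<bar>real_of_int (n $ j)\<bar>)" by (intro Max_in) auto
  then obtain j where j: "?M = \<bar>real_of_int (n $ j)\<bar>" by (elim imageE) (rule that)
  have "norm (real_vec n) \<le> (\<Sum>i\<in>UNIV. \<bar>real_of_int (n $ i)\<bar>)"
    using norm_le_l1_cart[of "real_vec n"] by simp
  also have "\<dots> \<le> real CARD('d) * \<bar>real_of_int (n $ j)\<bar>"
    unfolding j[symmetric] by (intro sum_bounded_above) auto
  finally have 1: "norm (real_vec n) \<le> real CARD('d) * max 1 \<bar>real_of_int (n $ j)\<bar>"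
    by (rule order_trans) (intro mult_left_mono, auto)
  have "bracket n \<le> 1 + norm (real_vec n)"
    unfolding bracket_def by (rule real_le_lsqrt) (auto simp: power2_eq_square algebra_simps)
  also have "\<dots> \<le> max 1 \<bar>real_of_int (n $ j)\<bar> + real CARD('d) * max 1 \<bar>real_of_int (n $ j)\<bar>"
    by (intro add_mono 1) simp
  finally show ?thesis by (intro exI[of _ j]) (simp add: algebra_simps)
qed

text \<open>To gain \<open>K\<close> powers of \<open>bracket n\<close> one integrates by parts \<open>L = K + nat \<lceil>m\<rceil>\<close> times in the direction of
  a coordinate of \<open>n\<close> that is comparable to \<open>bracket n\<close> (for \<open>n \<noteq> 0\<close>): the additional integrations pay for
  the growth of the symbol. The seminorms that occur are those of the pure derivatives up to order \<open>L\<close>.\<close>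
lemma transpose_coeff_decay:
  fixes a :: "real ^ 'd::finite \<Rightarrow> int ^ 'd \<Rightarrow> complex"
  assumes a: "a \<in> symbol_class m"
  obtains C B where "finite B" "0 \<le> C" "\<And>\<phi> n. \<phi> \<in> test_functions \<Longrightarrow>
    bracket n ^ K * norm (transpose_coeff a \<phi> n) \<le> C * (\<Sum>\<beta>\<in>B. test_seminorm \<beta> \<phi>)"
proof -
  let ?M = "nat \<lceil>m\<rceil>"
  define L where "L = K + ?M"
  have "\<forall>\<beta>. \<exists>A\<ge>0. \<forall>x n. norm (multi_deriv \<beta> (\<lambda>y. a y n) x) \<le> A * bracket n ^ ?M"
    using symbol_deriv_bound[OF a] by blast
  from choice[OF this] obtain A where A: "\<And>\<beta>. 0 \<le> A \<beta>"
      "\<And>\<beta> x n. norm (multi_deriv \<beta> (\<lambda>y. a y n) x) \<le> A \<beta> * bracket n ^ ?M"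
    by blast
  define B :: "(nat ^ 'd) set" where "B = (\<lambda>(j, l). axis j l) ` (UNIV \<times> {..L})"
  have B: "finite B" "\<And>j l. l \<le> L \<Longrightarrow> axis j l \<in> B" by (auto simp: B_def)
  define A\<^sub>0 where "A\<^sub>0 = sum A B"
  have "0 \<le> A\<^sub>0" unfolding A\<^sub>0_def by (intro sum_nonneg A)
  let ?V = "(2 * pi) ^ CARD('d)"
  let ?D = "real CARD('d) + 1"
  have "bracket n ^ K * norm (transpose_coeff a \<phi> n)
      \<le> ?D ^ L * 2 ^ L * A\<^sub>0 * (\<Sum>\<beta>\<in>B. test_seminorm \<beta> \<phi>)" if \<phi>: "\<phi> \<in> test_functions" for \<phi> n
  proof -
    let ?N = "\<Sum>\<beta>\<in>B. test_seminorm \<beta> \<phi>"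
    define I where "I = norm (torus_integral (\<lambda>x. a x n * character n x * \<phi> x))"
    define R where "R = ?V * 2 ^ L * (A\<^sub>0 * bracket n ^ ?M * ?N)"
    have "0 \<le> ?N" using \<phi> by (intro sum_nonneg test_seminorm_nonneg)
    have decay: "\<bar>real_of_int (n $ j)\<bar> ^ k * I \<le> R" if "k \<le> L" for j k
    proof -
      have "\<bar>real_of_int (n $ j)\<bar> ^ k * I \<le> ?V * 2 ^ k * (A\<^sub>0 * bracket n ^ ?M * ?N)"
        unfolding I_def
      proof (rule oscillatory_integral_decay[OF symbol_test_function[OF a] \<phi>])
        fix l x assume "l \<le> k"
        then have in_B: "axis j l \<in> B" using \<open>k \<le> L\<close> B(2) by simp
        have "norm (multi_deriv (axis j l) (\<lambda>y. a y n) x) \<le> A (axis j l) * bracket n ^ ?M" by (rule A)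
        also have "\<dots> \<le> A\<^sub>0 * bracket n ^ ?M"
          unfolding A\<^sub>0_def using in_B B(1) A(1) bracket_pos[of n]
          by (intro mult_right_mono member_le_sum) auto
        finally show "norm ((partial_deriv j ^^ l) (\<lambda>x. a x n) x) \<le> A\<^sub>0 * bracket n ^ ?M"
          by (simp add: multi_power_axis)
        have "norm (multi_deriv (axis j l) \<phi> x) \<le> test_seminorm (axis j l) \<phi>"
          by (rule multi_deriv_le_test_seminorm[OF \<phi>])
        also have "\<dots> \<le> ?N"
          using in_B B(1) test_seminorm_nonneg[OF \<phi>] by (intro member_le_sum) auto
        finally show "norm ((partial_deriv j ^^ l) \<phi> x) \<le> ?N"
          by (simp add: multi_power_axis)
      qed
      also have "\<dots> \<le> R"
        unfolding R_def using that \<open>0 \<le> A\<^sub>0\<close> \<open>0 \<le> ?N\<close> bracket_pos[of n]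
        by (intro mult_right_mono mult_left_mono power_increasing) auto
      finally show ?thesis .
    qed
    obtain j where j: "bracket n \<le> ?D * max 1 \<bar>real_of_int (n $ j)\<bar>"
      using bracket_le_max_component[of n] by blast
    \<comment> \<open>When the coordinate is smaller than one, the trivial bound without integration by parts is used.\<close>
    have "max 1 \<bar>real_of_int (n $ j)\<bar> ^ L * I \<le> R"
      using decay[of 0 j] decay[of L j] by (auto simp: max_def)
    then have "?D ^ L * (max 1 \<bar>real_of_int (n $ j)\<bar> ^ L * I) \<le> ?D ^ L * R"
      by (rule mult_left_mono) simp
    moreover have "bracket n ^ L * I \<le> (?D * max 1 \<bar>real_of_int (n $ j)\<bar>) ^ L * I"
      using j by (intro mult_right_mono power_mono) (auto simp: I_def)
    ultimately have "bracket n ^ L * I \<le> ?D ^ L * R"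
      unfolding power_mult_distrib mult.assoc by linarith
    then have "bracket n ^ ?M * (bracket n ^ K * I) \<le> bracket n ^ ?M * (?D ^ L * (?V * (2 ^ L * (A\<^sub>0 * ?N))))"
      unfolding R_def by (simp add: L_def power_add mult_ac)
    then have "bracket n ^ K * I \<le> ?D ^ L * (?V * (2 ^ L * (A\<^sub>0 * ?N)))"
      using bracket_pos[of n] by (subst (asm) mult_le_cancel_left_pos) auto
    moreover have "I = ?V * norm (transpose_coeff a \<phi> n)"
      by (simp add: I_def transpose_coeff_def norm_divide norm_power norm_mult)
    ultimately have "?V * (bracket n ^ K * norm (transpose_coeff a \<phi> n)) \<le> ?V * (?D ^ L * 2 ^ L * A\<^sub>0 * ?N)"
      by (simp add: mult_ac)
    then show ?thesis by (subst (asm) mult_le_cancel_left_pos) auto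
  qed
  moreover have "0 \<le> ?D ^ L * 2 ^ L * A\<^sub>0" using \<open>0 \<le> A\<^sub>0\<close> by simp
  ultimately show ?thesis using that[OF B(1)] by blast
qed

text \<open>An additional \<open>2 d\<close> powers of decay buy summability over the lattice.\<close>
lemma transpose_coeff_weighted_sum:
  fixes a :: "real ^ 'd::finite \<Rightarrow> int ^ 'd \<Rightarrow> complex"
  assumes a: "a \<in> symbol_class m"
  obtains C B where "finite B" "0 \<le> C"
    "\<And>\<phi>. \<phi> \<in> test_functions \<Longrightarrow> (\<lambda>n. bracket n ^ K * norm (transpose_coeff a \<phi> n)) summable_on UNIV"
    "\<And>\<phi>. \<phi> \<in> test_functions \<Longrightarrow>
      (\<Sum>\<^sub>\<infinity>n. bracket n ^ K * norm (transpose_coeff a \<phi> n)) \<le> C * (\<Sum>\<beta>\<in>B. test_seminorm \<beta> \<phi>)"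
proof -
  let ?w = "\<lambda>n::int ^ 'd. 1 / bracket n ^ (2 * CARD('d))"
  obtain C B where CB: "finite B" "0 \<le> C" "\<And>\<phi> n. \<phi> \<in> test_functions \<Longrightarrow>
    bracket n ^ (K + 2 * CARD('d)) * norm (transpose_coeff a \<phi> n) \<le> C * (\<Sum>\<beta>\<in>B. test_seminorm \<beta> \<phi>)"
    by (rule transpose_coeff_decay[OF a]) (rule that)
  have le: "bracket n ^ K * norm (transpose_coeff a \<phi> n) \<le> C * (\<Sum>\<beta>\<in>B. test_seminorm \<beta> \<phi>) * ?w n"
    if "\<phi> \<in> test_functions" for \<phi> n
    using CB(3)[OF that, of n] bracket_pos[of n] by (simp add: power_add field_simps)
  have sw: "(\<lambda>n. C * (\<Sum>\<beta>\<in>B. test_seminorm \<beta> \<phi>) * ?w n) summable_on UNIV" for \<phi>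
    by (intro summable_on_cmult_right bracket_power_summable)
  have s: "(\<lambda>n. bracket n ^ K * norm (transpose_coeff a \<phi> n)) summable_on UNIV"
    if "\<phi> \<in> test_functions" for \<phi>
    by (rule summable_on_comparison_test[OF sw le[OF that]]) simp
  have "(\<Sum>\<^sub>\<infinity>n. bracket n ^ K * norm (transpose_coeff a \<phi> n))
      \<le> C * infsum ?w UNIV * (\<Sum>\<beta>\<in>B. test_seminorm \<beta> \<phi>)" if "\<phi> \<in> test_functions" for \<phi>
    using infsum_mono[OF s[OF that] sw le[OF that]]
    unfolding infsum_cmult_right' by (simp only: mult_ac)
  moreover have "0 \<le> C * infsum ?w UNIV"
    using CB(2) by (intro mult_nonneg_nonneg infsum_nonneg) auto
  ultimately show ?thesis using that[OF CB(1) _ s] by blast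
qed

lemma rapidly_decreasing_transpose_coeff:
  assumes "a \<in> symbol_class m" "\<phi> \<in> test_functions"
  shows "rapidly_decreasing (transpose_coeff a \<phi>)"
  unfolding rapidly_decreasing_def
proof
  fix k
  show "(\<lambda>n. bracket n ^ k * norm (transpose_coeff a \<phi> n)) summable_on UNIV"
    by (rule transpose_coeff_weighted_sum[OF assms(1), of k]) (use assms(2) in blast)
qed

lemma transposed_test_function:
  "a \<in> symbol_class m \<Longrightarrow> \<phi> \<in> test_functions \<Longrightarrow> transposed a \<phi> \<in> test_functions"
  unfolding transposed_def by (intro fourier_sum_test_function rapidly_decreasing_transpose_coeff)

lemma test_seminorm_transposed_le:
  fixes a :: "real ^ 'd::finite \<Rightarrow> int ^ 'd \<Rightarrow> complex"
  assumes a: "a \<in> symbol_class m"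
  shows "\<exists>C B. finite B \<and> 0 \<le> C \<and> (\<forall>\<phi>\<in>test_functions.
    test_seminorm \<beta> (transposed a \<phi>) \<le> C * (\<Sum>\<gamma>\<in>B. test_seminorm \<gamma> \<phi>))"
proof -
  obtain K where K: "\<And>c. rapidly_decreasing c \<Longrightarrow>
      test_seminorm \<beta> (fourier_sum c) \<le> (\<Sum>\<^sub>\<infinity>n. bracket n ^ K * norm (c n))"
    by (rule test_seminorm_fourier_sum_le) (rule that)
  obtain C B where CB: "finite B" "0 \<le> C"
    "\<And>\<phi>. \<phi> \<in> test_functions \<Longrightarrow> (\<lambda>n. bracket n ^ K * norm (transpose_coeff a \<phi> n)) summable_on UNIV"
    "\<And>\<phi>. \<phi> \<in> test_functions \<Longrightarrow>
      (\<Sum>\<^sub>\<infinity>n. bracket n ^ K * norm (transpose_coeff a \<phi> n)) \<le> C * (\<Sum>\<beta>\<in>B. test_seminorm \<beta> \<phi>)"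
    by (rule transpose_coeff_weighted_sum[OF a]) (rule that)
  have "test_seminorm \<beta> (transposed a \<phi>) \<le> C * (\<Sum>\<gamma>\<in>B. test_seminorm \<gamma> \<phi>)" if "\<phi> \<in> test_functions" for \<phi>
    unfolding transposed_def
    using K[OF rapidly_decreasing_transpose_coeff[OF a that]] CB(4)[OF that] by (rule order_trans)
  with CB(1,2) show ?thesis by blast
qed

lemma continuous_symbol_integrand:
  assumes "a \<in> symbol_class m" "\<phi> \<in> test_functions"
  shows "continuous_on UNIV (\<lambda>x. a x n * character n x * \<phi> x)"
  by (intro continuous_intros continuous_character smooth_continuous test_functionsD(1) assms(2)
      symbol_test_function[OF assms(1)])

lemma transposed_lincomb:
  assumes a: "a \<in> symbol_class m" and "\<phi> \<in> test_functions" "\<psi> \<in> test_functions"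
  shows "transposed a (\<lambda>x. c * \<phi> x + \<psi> x) = (\<lambda>x. c * transposed a \<phi> x + transposed a \<psi> x)"
proof -
  have "transpose_coeff a (\<lambda>x. c * \<phi> x + \<psi> x) n = c * transpose_coeff a \<phi> n + transpose_coeff a \<psi> n" for n
    using torus_integral_lincomb[OF continuous_symbol_integrand[OF a assms(2)]
        continuous_symbol_integrand[OF a assms(3)], of c n n]
    by (simp add: transpose_coeff_def ring_distribs add_divide_distrib mult_ac)
  then have eq: "transpose_coeff a (\<lambda>x. c * \<phi> x + \<psi> x) = (\<lambda>n. c * transpose_coeff a \<phi> n + transpose_coeff a \<psi> n)"
    by (rule ext)
  show ?thesis
    unfolding transposed_def eq
    by (intro ext fourier_sum_lincomb rapidly_decreasing_transpose_coeff[OF a] assms(2,3))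
qed

lemma transposed_bounded:
  fixes a :: "real ^ 'd::finite \<Rightarrow> int ^ 'd \<Rightarrow> complex"
  assumes a: "a \<in> symbol_class m" and E: "E \<in> bounded_test_sets"
  shows "transposed a ` E \<in> bounded_test_sets"
proof -
  have E': "E \<noteq> {}" "E \<subseteq> test_functions" using E by (auto simp: bounded_test_sets_def)
  have "bdd_above (test_seminorm \<beta> ` transposed a ` E)" for \<beta>
  proof -
    obtain C B where CB: "finite B" "0 \<le> C" "\<forall>\<phi>\<in>test_functions.
        test_seminorm \<beta> (transposed a \<phi>) \<le> C * (\<Sum>\<gamma>\<in>B. test_seminorm \<gamma> \<phi>)"
      using test_seminorm_transposed_le[OF a, of \<beta>] by (elim exE conjE) (rule that)
    have "\<forall>\<gamma>. \<exists>M. \<forall>\<phi>\<in>E. test_seminorm \<gamma> \<phi> \<le> M"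
      using E by (auto simp: bounded_test_sets_def bdd_above_def)
    from choice[OF this] obtain M where M: "\<And>\<gamma> \<phi>. \<phi> \<in> E \<Longrightarrow> test_seminorm \<gamma> \<phi> \<le> M \<gamma>" by blast
    have "test_seminorm \<beta> (transposed a \<phi>) \<le> C * (\<Sum>\<gamma>\<in>B. M \<gamma>)" if "\<phi> \<in> E" for \<phi>
    proof -
      have "\<phi> \<in> test_functions" using that E'(2) by blast
      with CB(3) have "test_seminorm \<beta> (transposed a \<phi>) \<le> C * (\<Sum>\<gamma>\<in>B. test_seminorm \<gamma> \<phi>)" by (rule bspec)
      also have "\<dots> \<le> C * (\<Sum>\<gamma>\<in>B. M \<gamma>)"
        by (intro mult_left_mono sum_mono M[OF that] CB(2))
      finally show ?thesis .
    qed
    then show ?thesis by (auto simp: bdd_above_def)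
  qed
  then show ?thesis
    using E' transposed_test_function[OF a] by (auto simp: bounded_test_sets_def)
qed

section \<open>Quantization as precomposition with the transposed operator\<close>

lemma quantization_term_eq:
  fixes a :: "real ^ 'd::finite \<Rightarrow> int ^ 'd \<Rightarrow> complex"
  assumes "a \<in> symbol_class m" "\<phi> \<in> test_functions"
  shows "quantization_term a f n \<phi> = transpose_coeff a \<phi> n * f (character (- n))"
proof -
  have "quantization_term a f n \<phi>
      = torus_integral (\<lambda>x. distr_fourier_coeff f n * (a x n * character n x * \<phi> x) + 0)"
    using assms(2) by (simp add: quantization_term_def distribution_of_def mult_ac)
  also have "\<dots> = distr_fourier_coeff f n * torus_integral (\<lambda>x. a x n * character n x * \<phi> x) + torus_integral (\<lambda>x::real^'d. 0)"
    by (rule torus_integral_lincomb) (auto intro: continuous_symbol_integrand[OF assms])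
  also have "torus_integral (\<lambda>x::real^'d. 0) = 0" by (simp add: torus_integral_def)
  finally show ?thesis by (simp add: transpose_coeff_def distr_fourier_coeff_def)
qed

lemma quantization_has_sum:
  assumes "a \<in> symbol_class m" "f \<in> distributions" "\<phi> \<in> test_functions"
  shows "((\<lambda>n. quantization_term a f n \<phi>) has_sum f (transposed a \<phi>)) UNIV"
  unfolding quantization_term_eq[OF assms(1,3)] transposed_def
  by (rule distribution_fourier_sum[OF assms(2) rapidly_decreasing_transpose_coeff[OF assms(1,3)]])

lemma quantization_eq:
  "a \<in> symbol_class m \<Longrightarrow> f \<in> distributions \<Longrightarrow> \<phi> \<in> test_functions \<Longrightarrow>
    quantization a f \<phi> = f (transposed a \<phi>)"
  by (simp add: quantization_def infsumI[OF quantization_has_sum])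

lemma quantization_distribution:
  fixes a :: "real ^ 'd::finite \<Rightarrow> int ^ 'd \<Rightarrow> complex"
  assumes a: "a \<in> symbol_class m" and f: "f \<in> distributions"
  shows "quantization a f \<in> distributions"
proof -
  obtain B C where B: "finite B" "0 \<le> C"
      "\<And>\<phi>. \<phi> \<in> test_functions \<Longrightarrow> norm (f \<phi>) \<le> C * (\<Sum>\<beta>\<in>B. test_seminorm \<beta> \<phi>)"
    by (rule distribution_bound[OF f]) (rule that)
  have "\<forall>\<beta>. \<exists>C E. finite E \<and> 0 \<le> C \<and> (\<forall>\<phi>\<in>test_functions.
      test_seminorm \<beta> (transposed a \<phi>) \<le> C * (\<Sum>\<gamma>\<in>E. test_seminorm \<gamma> \<phi>))"
    using test_seminorm_transposed_le[OF a] by blast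
  from choice[OF this] obtain D where "\<forall>\<beta>. \<exists>E. finite E \<and> 0 \<le> D \<beta> \<and> (\<forall>\<phi>\<in>test_functions.
      test_seminorm \<beta> (transposed a \<phi>) \<le> D \<beta> * (\<Sum>\<gamma>\<in>E. test_seminorm \<gamma> \<phi>))" by (elim exE) (rule that)
  from choice[OF this] obtain E where DE: "\<forall>\<beta>. finite (E \<beta>) \<and> 0 \<le> D \<beta> \<and> (\<forall>\<phi>\<in>test_functions.
      test_seminorm \<beta> (transposed a \<phi>) \<le> D \<beta> * (\<Sum>\<gamma>\<in>E \<beta>. test_seminorm \<gamma> \<phi>))" by (elim exE) (rule that)
  let ?E = "\<Union>\<beta>\<in>B. E \<beta>"
  have fin: "finite ?E" using B(1) DE by blast
  show ?thesis
  proof (rule distributionI)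
    show "quantization a f \<in> extensional test_functions" by (simp add: quantization_def)
    show "quantization a f (\<lambda>x. \<phi> x + \<psi> x) = quantization a f \<phi> + quantization a f \<psi>"
      if "\<phi> \<in> test_functions" "\<psi> \<in> test_functions" for \<phi> \<psi>
      using transposed_lincomb[OF a that, of 1]
        distribution_add[OF f transposed_test_function[OF a that(1)]
          transposed_test_function[OF a that(2)]]
      by (simp add: quantization_eq[OF a f] that test_functions_add)
    show "quantization a f (\<lambda>x. c * \<phi> x) = c * quantization a f \<phi>" if \<phi>: "\<phi> \<in> test_functions" for \<phi> c
    proof -
      have "transposed a (\<lambda>x. 0) = (\<lambda>x. 0)"
        using transposed_lincomb[OF a zero_test_function zero_test_function, of "-1"] by simp
      then show ?thesis
        using transposed_lincomb[OF a \<phi> zero_test_function, of c]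
          distribution_cmult[OF f transposed_test_function[OF a \<phi>]]
        by (simp add: quantization_eq[OF a f] \<phi> test_functions_cmult)
    qed
    show "finite ?E" by (rule fin)
    show "0 \<le> C * sum D B" using B(2) DE by (intro mult_nonneg_nonneg sum_nonneg) auto
    show "norm (quantization a f \<phi>) \<le> C * sum D B * (\<Sum>\<gamma>\<in>?E. test_seminorm \<gamma> \<phi>)"
      if \<phi>: "\<phi> \<in> test_functions" for \<phi>
    proof -
      have "norm (quantization a f \<phi>) \<le> C * (\<Sum>\<beta>\<in>B. test_seminorm \<beta> (transposed a \<phi>))"
        unfolding quantization_eq[OF a f \<phi>] by (rule B(3)[OF transposed_test_function[OF a \<phi>]])
      also have "\<dots> \<le> C * (\<Sum>\<beta>\<in>B. D \<beta> * (\<Sum>\<gamma>\<in>?E. test_seminorm \<gamma> \<phi>))"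
      proof (intro mult_left_mono sum_mono B(2))
        fix \<beta> assume "\<beta> \<in> B"
        have "test_seminorm \<beta> (transposed a \<phi>) \<le> D \<beta> * (\<Sum>\<gamma>\<in>E \<beta>. test_seminorm \<gamma> \<phi>)"
          using DE \<phi> by blast
        also have "\<dots> \<le> D \<beta> * (\<Sum>\<gamma>\<in>?E. test_seminorm \<gamma> \<phi>)"
          using DE \<open>\<beta> \<in> B\<close> fin test_seminorm_nonneg[OF \<phi>] by (intro mult_left_mono sum_mono2) auto
        finally show "test_seminorm \<beta> (transposed a \<phi>) \<le> D \<beta> * (\<Sum>\<gamma>\<in>?E. test_seminorm \<gamma> \<phi>)" .
      qed
      finally show ?thesis by (simp add: sum_distrib_right mult.assoc)
    qed
  qed
qed

lemma continuous_map_quantization: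
  assumes a: "a \<in> symbol_class m" and "T \<in> {strong_dual_topology, weak_star_topology}"
  shows "continuous_map T T (quantization a)"
  by (rule continuous_map_transpose[where G = "transposed a"])
    (simp_all add: assms quantization_distribution[OF a] transposed_test_function[OF a]
      quantization_eq[OF a] transposed_bounded[OF a] del: insert_iff)

section \<open>Fourier coefficients and the triangular condition\<close>

lemma transpose_coeff_character:
  "transpose_coeff a (character (- k)) n = symbol_coeff a (k - n) n"
  by (simp add: transpose_coeff_def symbol_coeff_def fourier_coeff_def mult.assoc character_mult)

lemma distr_fourier_coeff_quantization:
  fixes a :: "real ^ 'd::finite \<Rightarrow> int ^ 'd \<Rightarrow> complex"
  assumes "a \<in> symbol_class m"
  shows "distr_fourier_coeff (quantization a f) k =
    (\<Sum>\<^sub>\<infinity>n. symbol_coeff a (k - n) n * distr_fourier_coeff f n)"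
proof -
  have "distr_fourier_coeff (quantization a f) k
      = (\<Sum>\<^sub>\<infinity>n. symbol_coeff a (k - n) n * f (character (- n))) * inverse ((2 * of_real pi) ^ CARD('d))"
    by (simp add: distr_fourier_coeff_def quantization_def character_test_function
        quantization_term_eq[OF assms character_test_function] transpose_coeff_character divide_inverse)
  also have "\<dots> = (\<Sum>\<^sub>\<infinity>n. symbol_coeff a (k - n) n * distr_fourier_coeff f n)"
    unfolding infsum_cmult_left'[symmetric] by (simp add: distr_fourier_coeff_def divide_inverse mult.assoc)
  finally show ?thesis .
qed

lemma distribution_of_character:
  fixes n :: "int ^ 'd::finite"
  shows "distribution_of (character n) \<in> distributions"
    and "distr_fourier_coeff (distribution_of (character n)) k = (if k = n then 1 else 0)"
proof -
  have cont: "continuous_on UNIV (\<lambda>x. character n x * \<phi> x)" if "\<phi> \<in> test_functions" for \<phi>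
    by (intro continuous_intros continuous_character smooth_continuous test_functionsD(1) that)
  have lincomb: "torus_integral (\<lambda>x. character n x * (c * \<phi> x + \<psi> x))
      = c * torus_integral (\<lambda>x. character n x * \<phi> x) + torus_integral (\<lambda>x. character n x * \<psi> x)"
    if "\<phi> \<in> test_functions" "\<psi> \<in> test_functions" for c \<phi> \<psi>
    using torus_integral_lincomb[OF cont[OF that(1)] cont[OF that(2)], of c]
    by (simp add: ring_distribs mult.left_commute)
  have zero: "torus_integral (\<lambda>x::real^'d. 0) = 0" by (simp add: torus_integral_def)
  show "distribution_of (character n) \<in> distributions"
  proof (rule distributionI[where B = "{0}" and C = "(2 * pi) ^ CARD('d)"])
    show "distribution_of (character n) \<in> extensional test_functions"
      by (simp add: distribution_of_def)
    show "distribution_of (character n) (\<lambda>x. \<phi> x + \<psi> x) =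
        distribution_of (character n) \<phi> + distribution_of (character n) \<psi>"
      if "\<phi> \<in> test_functions" "\<psi> \<in> test_functions" for \<phi> \<psi>
      using lincomb[OF that, of 1] that by (simp add: distribution_of_def test_functions_add)
    show "distribution_of (character n) (\<lambda>x. c * \<phi> x) = c * distribution_of (character n) \<phi>"
      if "\<phi> \<in> test_functions" for c \<phi>
      using lincomb[OF that zero_test_function, of c] that
      by (simp add: distribution_of_def test_functions_cmult zero)
    show "norm (distribution_of (character n) \<phi>) \<le> (2 * pi) ^ CARD('d) * (\<Sum>\<beta>\<in>{0}. test_seminorm \<beta> \<phi>)"
      if "\<phi> \<in> test_functions" for \<phi>
      using norm_torus_integral_le[OF cont[OF that], of "test_seminorm 0 \<phi>"]
        multi_deriv_le_test_seminorm[OF that, of 0] that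
      by (simp add: distribution_of_def norm_mult multi_power_zero)
  qed auto
  show "distr_fourier_coeff (distribution_of (character n)) k = (if k = n then 1 else 0)"
    by (simp add: distr_fourier_coeff_def distribution_of_def character_test_function character_mult
        torus_integral_character)
qed

text \<open>If the condition holds, then in the sum for a coefficient outside the orthant either the symbol
  or the distribution contributes a zero factor to each term. Its necessity is seen on the characters
  of the orthant, for which the sum has a single term.\<close>
lemma quantization_preserves_plus_iff_triangular:
  fixes a :: "real ^ 'd::finite \<Rightarrow> int ^ 'd \<Rightarrow> complex"
  assumes a: "a \<in> symbol_class m"
  shows "quantization a ` plus_distributions \<subseteq> plus_distributions \<longleftrightarrow> triangular a"
proof
  assume sub: "quantization a ` plus_distributions \<subseteq> plus_distributions"
  show "triangular a" unfolding triangular_def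
  proof (intro allI impI)
    fix n \<nu> :: "int ^ 'd"
    assume n: "n \<in> nonneg_lattice \<and> n + \<nu> \<notin> nonneg_lattice"
    let ?f = "distribution_of (character n)"
    have "?f \<in> plus_distributions"
      using n by (auto simp: plus_distributions_def distribution_of_character)
    then have "quantization a ?f \<in> plus_distributions" using sub by blast
    then have "distr_fourier_coeff (quantization a ?f) (n + \<nu>) = 0"
      using n by (simp add: plus_distributions_def)
    also have "distr_fourier_coeff (quantization a ?f) (n + \<nu>)
        = (\<Sum>\<^sub>\<infinity>k\<in>{n}. symbol_coeff a (n + \<nu> - k) k)"
      unfolding distr_fourier_coeff_quantization[OF a] distribution_of_character(2)
      by (rule infsum_cong_neutral) auto
    finally show "symbol_coeff a \<nu> n = 0" by simp
  qed
next
  assume tri: "triangular a"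
  show "quantization a ` plus_distributions \<subseteq> plus_distributions"
  proof (rule image_subsetI)
    fix f :: "(real ^ 'd \<Rightarrow> complex) \<Rightarrow> complex"
    assume f: "f \<in> plus_distributions"
    have "distr_fourier_coeff (quantization a f) k = 0" if k: "k \<notin> nonneg_lattice" for k
    proof -
      have "symbol_coeff a (k - n) n * distr_fourier_coeff f n = 0" for n
      proof (cases "n \<in> nonneg_lattice")
        case True
        then show ?thesis using tri k unfolding triangular_def by (auto dest: spec[of _ n] spec[of _ "k - n"])
      next
        case False
        then show ?thesis using f by (simp add: plus_distributions_def)
      qed
      then show ?thesis
        unfolding distr_fourier_coeff_quantization[OF a] by (rule infsum_0)
    qed
    then show "quantization a f \<in> plus_distributions"
      using f quantization_distribution[OF a] by (simp add: plus_distributions_def)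
  qed
qed

theorem proposition4p1:
  fixes m :: real
    and a :: "real ^ 'd::finite \<Rightarrow> int ^ 'd \<Rightarrow> complex"
    and T :: "((real ^ 'd \<Rightarrow> complex) \<Rightarrow> complex) topology"
  assumes "a \<in> symbol_class m"
    and "T \<in> {strong_dual_topology, weak_star_topology}"
  shows "((\<forall>f\<in>plus_distributions. quantization_converges a f) \<and>
          continuous_map (subtopology T plus_distributions) (subtopology T plus_distributions)
            (quantization a))
         \<longleftrightarrow> triangular a"
proof -
  have "topspace T = distributions"
    using assms(2) topspace_strong_dual_topology topspace_weak_star_topology by auto
  then have "topspace (subtopology T plus_distributions) = plus_distributions"
    by (auto simp: plus_distributions_def)
  moreover have "continuous_map (subtopology T plus_distributions) T (quantization a)"
    by (intro continuous_map_from_subtopology continuous_map_quantization[OF assms])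
  ultimately have "continuous_map (subtopology T plus_distributions) (subtopology T plus_distributions)
      (quantization a) \<longleftrightarrow> quantization a ` plus_distributions \<subseteq> plus_distributions"
    by (simp add: continuous_map_in_subtopology image_subset_iff_funcset)
  moreover have "\<forall>f\<in>plus_distributions. quantization_converges a f"
    using quantization_has_sum[OF assms(1)] summable_on_def
    by (fastforce simp: plus_distributions_def quantization_converges_def)
  ultimately show ?thesis
    using quantization_preserves_plus_iff_triangular[OF assms(1)] by blast
qed

end
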